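(* For every $m\geq 1$ and every $1\leq k\leq m$, there exist a finite group $H$ and a homomorphism $\varphi:H\to\mathrm{GL}(m,\mathbb{Z})$ such that the semidirect product $G=\mathbb{Z}^m\rtimes_\varphi H$ satisfies that $\mathrm{RF}_G$ equals $\log^k$. In particular, for every $k\in\mathbb{N}$, there exists a finitely generated, residually finite group $G$ such that $\mathrm{RF}_G$ equals $\log^k$.
   Context: Let $G$ be a finitely generated residually finite group with finite generating set $S$. Let $B_G(r)$ be the set of elements of $G$ that are products of at most $r$ elements of $S\cup S^{-1}$, and let $\nu(G)$ be the set of normal subgroups of finite index of $G$. For $g \neq e_G$ put $D_{G,\nu(G)}(g)=\min\{[G:N]\mid N\in\nu(G),\ g\notin N\}$, and for $r\in\mathbb{R}_{\geq 1}$ put $\mathrm{RF}_{G,\nu(G),B_G}(r)=\max\{D_{G,\nu(G)}(g)\mid e_G\neq g\in B_G(r)\}$. For increasing functions $f,g$ on $\mathbb{R}_{\geq 1}$, write $f\preceq g$ if there is $C>0$ with $f(r)\leq C\,g(Cr)$ for all $r\geq\max\{1,1/C\}$, and $f\approx g$ if $f\preceq g$ and $g\preceq f$. We say $\mathrm{RF}_G$ equals $f$ if $\mathrm{RF}_{G,\nu(G),B_G}\approx f$ for some (equivalently, every) finite generating set $S$. Here $\log^k$ denotes $r\mapsto(\log r)^k$, with $\log^0$ the constant function $1$; the relations above are applied to $\log^k$ by the same formula. *)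

theory Defs
  imports
    Complex_Main
    "HOL-Algebra.Generated_Groups"
    "Jordan_Normal_Form.Matrix"
begin

section \<open>Residual finiteness growth\<close>

definition finite_index_normal :: "('a, 'b) monoid_scheme \<Rightarrow> 'a set set" where
  "finite_index_normal G = {N. N \<lhd> G \<and> finite (rcosets\<^bsub>G\<^esub> N)}"

definition residually_finite :: "('a, 'b) monoid_scheme \<Rightarrow> bool" where
  "residually_finite G \<longleftrightarrow>
     (\<forall>g \<in> carrier G - {\<one>\<^bsub>G\<^esub>}. \<exists>N \<in> finite_index_normal G. g \<notin> N)"

definition generating_set :: "('a, 'b) monoid_scheme \<Rightarrow> 'a set \<Rightarrow> bool" where
  "generating_set G S \<longleftrightarrow> S \<subseteq> carrier G \<and> generate G S = carrier G"

definition finitely_generated :: "('a, 'b) monoid_scheme \<Rightarrow> bool" where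
  "finitely_generated G \<longleftrightarrow> (\<exists>S. finite S \<and> generating_set G S)"

definition word_ball :: "('a, 'b) monoid_scheme \<Rightarrow> 'a set \<Rightarrow> real \<Rightarrow> 'a set" where
  "word_ball G S r =
     {foldr (\<otimes>\<^bsub>G\<^esub>) ws \<one>\<^bsub>G\<^esub> | ws.
        set ws \<subseteq> S \<union> (\<lambda>s. inv\<^bsub>G\<^esub> s) ` S \<and> real (length ws) \<le> r}"

definition divisibility :: "('a, 'b) monoid_scheme \<Rightarrow> 'a \<Rightarrow> nat" where
  "divisibility G g =
     (LEAST d. \<exists>N \<in> finite_index_normal G. g \<notin> N \<and> d = card (rcosets\<^bsub>G\<^esub> N))"

text \<open>Only meaningful for \<open>r \<ge> 1\<close>; for a finitely generated nontrivial group the maximum then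
  ranges over a finite nonempty set.\<close>

definition RF_growth :: "('a, 'b) monoid_scheme \<Rightarrow> 'a set \<Rightarrow> real \<Rightarrow> real" where
  "RF_growth G S r = real (Max (divisibility G ` (word_ball G S r - {\<one>\<^bsub>G\<^esub>})))"

definition growth_le :: "(real \<Rightarrow> real) \<Rightarrow> (real \<Rightarrow> real) \<Rightarrow> bool" where
  "growth_le f g \<longleftrightarrow> (\<exists>C>0. \<forall>r \<ge> max 1 (1 / C). f r \<le> C * g (C * r))"

definition growth_equiv :: "(real \<Rightarrow> real) \<Rightarrow> (real \<Rightarrow> real) \<Rightarrow> bool" where
  "growth_equiv f g \<longleftrightarrow> growth_le f g \<and> growth_le g f"

text \<open>The growth class is only defined for finitely generated residually finite groups, so these
  properties are part of the definition.\<close>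

definition RF_equals :: "('a, 'b) monoid_scheme \<Rightarrow> (real \<Rightarrow> real) \<Rightarrow> bool" where
  "RF_equals G f \<longleftrightarrow> group G \<and> residually_finite G \<and>
     (\<exists>S. finite S \<and> generating_set G S \<and> growth_equiv (RF_growth G S) f)"

section \<open>Semidirect products with integer lattices\<close>

definition GL_int :: "nat \<Rightarrow> int mat monoid" where
  "GL_int m = units_of (ring_mat TYPE(int) m ())"

definition semidirect_product ::
  "('a, 'c) monoid_scheme \<Rightarrow> ('b, 'd) monoid_scheme \<Rightarrow> ('b \<Rightarrow> 'a \<Rightarrow> 'a) \<Rightarrow> ('a \<times> 'b) monoid" where
  "semidirect_product N H \<theta> =
     \<lparr>carrier = carrier N \<times> carrier H,
      monoid.mult = (\<lambda>(u, h) (v, k). (u \<otimes>\<^bsub>N\<^esub> \<theta> h v, h \<otimes>\<^bsub>H\<^esub> k)),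
      one = (\<one>\<^bsub>N\<^esub>, \<one>\<^bsub>H\<^esub>)\<rparr>"

definition lattice_semidirect ::
  "nat \<Rightarrow> ('b, 'd) monoid_scheme \<Rightarrow> ('b \<Rightarrow> int mat) \<Rightarrow> (int vec \<times> 'b) monoid" where
  "lattice_semidirect m H \<phi> =
     semidirect_product (monoid_vec TYPE(int) m) H (\<lambda>h v. \<phi> h *\<^sub>v v)"

end

theory Submission
  imports Defs "HOL-Algebra.Weak_Morphisms" "HOL-Computational_Algebra.Primes" "HOL-Library.Countable"
begin

text \<open>
  Let the signed permutation matrices of the first \<open>k\<close> coordinates act on \<open>\<int>\<^sup>m\<close>, the remaining
  coordinates being fixed.  An element outside the lattice is detected by \<open>H\<close>.  A lattice
  vector in the ball of radius \<open>r\<close> has entries at most \<open>r\<close>, and since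
  \<open>lcm(1, \<dots>, 2s) \<ge> 2\<^sup>s\<close>, some \<open>c = O(log r)\<close> does not divide a chosen nonzero entry;
  reducing modulo \<open>c\<close> either the whole first block or a single fixed coordinate detects the vector
  in a quotient of order \<open>O(c\<^sup>k)\<close>.

  Conversely, if a normal subgroup contains a lattice vector \<open>w\<close>, sign changes and
  transpositions show that it contains \<open>2 w\<^sub>i e\<^sub>0\<close> for every \<open>i < k\<close>.  Hence a normal
  subgroup of finite index that contains no \<open>c e\<^sub>0\<close> with \<open>1 \<le> c \<le> n\<close> has
  index at least \<open>(n/2)\<^sup>k\<close>.  This applies to every normal subgroup of finite index avoiding
  \<open>M e\<^sub>0\<close>, where \<open>M \<le> 4\<^sup>n\<close> is a common multiple of \<open>1, \<dots>, n\<close>.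
\<close>

section \<open>Common multiples of initial segments\<close>

text \<open>Integrality in Leibniz's harmonic triangle: with \<open>L(n, k) = 1 / (k * (n choose k))\<close> one has
  \<open>L(n + 1, k) = L(n, k) - L(n + 1, k + 1)\<close>.\<close>

lemma mult_binomial_dvd_Lcm:
  assumes "1 \<le> k" "k \<le> n"
  shows "k * (n choose k) dvd Lcm {1..n::nat}"
  using assms
proof (induction n arbitrary: k)
  case 0
  then show ?case by simp
next
  case (Suc n)
  let ?D = "Lcm {1..Suc n}"
  from \<open>k \<le> Suc n\<close> \<open>1 \<le> k\<close> show ?case
  \<comment> \<open>Descending induction on \<open>k\<close> from \<open>Suc n\<close>: the entry
    \<open>k\<close> of the new row is obtained from the entry \<open>k\<close> of the previous row
    and the entry \<open>Suc k\<close> of the new one.\<close>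
  proof (induction rule: inc_induct)
    case base
    show ?case by (simp add: dvd_Lcm)
  next
    case (step k)
    then have k: "1 \<le> k" "k \<le> n" by auto
    have "k * (n choose k) dvd Lcm {1..n}" using Suc.IH k by blast
    also have "\<dots> dvd ?D" by (intro Lcm_subset) auto
    finally obtain x where x: "?D = k * (n choose k) * x" by blast
    have "Suc k * (Suc n choose Suc k) dvd ?D" using step.IH by simp
    then obtain y where y: "?D = Suc k * (Suc n choose Suc k) * y" by blast
    have 1: "Suc k * (Suc n choose Suc k) = (Suc n - k) * (Suc n choose k)"
      using k by (metis Suc_times_binomial_eq binomial_absorb_comp mult.commute diff_Suc_Suc binomial_absorption diff_Suc_1)
    have 2: "(Suc n - k) * (Suc n choose k) = Suc n * (n choose k)"
      using binomial_absorb_comp[of "Suc n" k] by simp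
    define c where "c = int (Suc n - k)"
    define a where "a = int (Suc n choose k)"
    define D where "D = int ?D"
    have c: "c = int (Suc n) - int k" "c \<noteq> 0" using k by (auto simp: c_def)
    have X: "int (Suc n) * D = c * a * int k * int x"
      using x 2 unfolding c_def a_def D_def by (metis (no_types, lifting) mult.assoc mult.left_commute of_nat_mult)
    have Y: "D = c * a * int y"
      using y 1 unfolding c_def a_def D_def by (metis of_nat_mult)
    \<comment> \<open>Writing \<open>c\<close> as \<open>Suc n - k\<close> lets \<open>X\<close> and
      \<open>Y\<close> be subtracted, after which \<open>c\<close> cancels. The computation is done
      in \<open>int\<close> because \<open>x - y\<close> could be truncated in
      \<open>nat\<close>.\<close>
    have "c * D = c * (int k * a * (int x - int y))"
    proof -
      have "c * D = int (Suc n) * D - int k * D" unfolding c(1) by (rule left_diff_distrib)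
      also have "\<dots> = c * a * int k * int x - int k * (c * a * int y)" unfolding X using Y by simp
      finally show ?thesis by (simp add: algebra_simps)
    qed
    then have "D = int k * a * (int x - int y)" using c by simp
    then have "int (k * (Suc n choose k)) dvd int ?D"
      by (simp add: D_def a_def)
    then show ?case using int_dvd_int_iff by blast
  qed
qed

text \<open>The central binomial coefficient is at least \<open>(2 * s / s) ^ s\<close>, and its
  multiple by \<open>s\<close> divides the least common multiple.\<close>

lemma two_power_le_Lcm:
  assumes "1 \<le> s"
  shows "2 ^ s \<le> Lcm {1..2 * s::nat}"
proof -
  have "(of_nat (2 * s) / of_nat s :: real) ^ s \<le> of_nat (2 * s choose s)"
    by (rule binomial_ge_n_over_k_pow_k) simp
  then have "(2::real) ^ s \<le> of_nat (2 * s choose s)" using assms by simp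
  then have "2 ^ s \<le> 2 * s choose s"
    by (metis of_nat_le_iff of_nat_numeral of_nat_power)
  also have "\<dots> \<le> s * (2 * s choose s)" using assms by simp
  also have "\<dots> \<le> Lcm {1..2 * s}"
  proof (rule dvd_imp_le[OF mult_binomial_dvd_Lcm])
    show "0 < Lcm {1..2 * s}" by (rule Nat.gr0I) (auto simp: Lcm_0_iff)
  qed (use assms in auto)
  finally show ?thesis .
qed

text \<open>If all of \<open>1, ..., 2 * s\<close> divided \<open>x\<close>, then so would their
  least common multiple, which is too large.\<close>

lemma ex_small_nondivisor:
  fixes x :: int
  assumes "x \<noteq> 0" "1 \<le> s" "\<bar>x\<bar> < 2 ^ s"
  obtains c where "1 \<le> c" "c \<le> 2 * s" "\<not> int c dvd x"
proof -
  have "\<exists>c\<in>{1..2 * s}. \<not> int c dvd x"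
  proof (rule ccontr)
    assume "\<not> ?thesis"
    then have "Lcm {1..2 * s} dvd nat \<bar>x\<bar>"
      by (intro Lcm_least) (auto simp: nat_dvd_iff)
    then have "Lcm {1..2 * s} \<le> nat \<bar>x\<bar>"
      using assms(1) by (intro dvd_imp_le) auto
    then have "2 ^ s \<le> nat \<bar>x\<bar>" using two_power_le_Lcm[OF assms(2)] by linarith
    then show False using assms(3) by (simp add: le_nat_iff)
  qed
  then show ?thesis using that by auto
qed

section \<open>Prime powers in central binomial coefficients\<close>

text \<open>Since \<open>i * (p ^ j choose i)\<close> is a multiple of \<open>p ^ j\<close>, a
  binomial coefficient prime to \<open>p\<close> would force \<open>p ^ j\<close> to divide the
  smaller number \<open>i\<close>.\<close>

lemma prime_dvd_prime_power_choose:
  fixes p :: nat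
  assumes "prime p" "0 < i" "i < p ^ j"
  shows "p dvd (p ^ j choose i)"
proof (rule ccontr)
  assume "\<not> ?thesis"
  then have "coprime (p ^ j) (p ^ j choose i)"
    using assms(1) by (simp add: prime_imp_coprime)
  moreover have "p ^ j dvd i * (p ^ j choose i)"
    using times_binomial_minus1_eq[OF assms(2), of "p ^ j"] by simp
  ultimately have "p ^ j dvd i" by (simp add: coprime_dvd_mult_left_iff)
  then show False using assms(2,3) by (simp add: nat_dvd_not_less)
qed

text \<open>Splitting \<open>2 * h\<close> as \<open>p ^ j\<close> plus a remainder, every term of
  Vandermonde's sum with \<open>0 < i \<le> h < p ^ j\<close> contains a factor divisible by
  \<open>p\<close>.\<close>

lemma prime_dvd_central_binomial:
  fixes p :: nat
  assumes "prime p" "h < p ^ j" "p ^ j \<le> 2 * h"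
  shows "p dvd (2 * h choose h)"
proof -
  \<comment> \<open>In Vandermonde's sum the term \<open>i = 0\<close> vanishes because \<open>2 * h - p ^ j < h\<close>.\<close>
  have "2 * h choose h = (\<Sum>i\<le>h. (p ^ j choose i) * (2 * h - p ^ j choose (h - i)))"
    using vandermonde[of "p ^ j" "2 * h - p ^ j" h] assms(3) by simp
  also have "p dvd \<dots>"
  proof (rule dvd_sum)
    fix i assume "i \<in> {..h}"
    then show "p dvd (p ^ j choose i) * (2 * h - p ^ j choose (h - i))"
      using assms prime_dvd_prime_power_choose[of p i j]
      by (cases "i = 0") (auto simp: binomial_eq_0)
  qed
  finally show ?thesis .
qed

text \<open>A common multiple of \<open>1, \<dots>, 2\<^sup>t\<close> of exponential size, which avoids Chebyshev's bound for the
  least common multiple: each prime power in \<open>(2\<^sup>s, 2\<^sup>s\<^sup>+\<^sup>1]\<close> contributes one factor \<open>p\<close>.\<close>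

definition binomial_tower :: "nat \<Rightarrow> nat" where
  "binomial_tower t = (\<Prod>s<t. 2 ^ Suc s choose 2 ^ s)"

text \<open>The factor for \<open>s\<close> is at most \<open>2 ^ 2 ^ Suc s = 4 ^ 2 ^ s\<close>, and
  the exponents \<open>2 ^ s\<close> with \<open>s < t\<close> sum to less than
  \<open>2 ^ t\<close>.\<close>

lemma binomial_tower_le: "binomial_tower t \<le> 4 ^ 2 ^ t"
proof (induction t)
  case (Suc t)
  have "binomial_tower (Suc t) \<le> 4 ^ 2 ^ t * 2 ^ 2 ^ Suc t"
    unfolding binomial_tower_def prod.lessThan_Suc
    by (intro mult_mono Suc.IH[unfolded binomial_tower_def] binomial_le_pow2) auto
  also have "\<dots> = 4 ^ 2 ^ Suc t"
    by (simp add: power_mult mult_2 power_add flip: power_mult_distrib)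
  finally show ?case .
qed (simp add: binomial_tower_def)

lemma binomial_tower_pos: "0 < binomial_tower t"
  unfolding binomial_tower_def by (intro prod_pos) auto

lemma prime_power_dvd_binomial_tower:
  fixes p :: nat
  assumes "prime p" "p ^ j \<le> 2 ^ t"
  shows "p ^ j dvd binomial_tower t"
  using assms(2)
proof (induction t arbitrary: j)
  case 0
  have "0 < p ^ j" using prime_gt_0_nat[OF assms(1)] by simp
  moreover have "p ^ j \<le> 1" using 0 by simp
  ultimately have "p ^ j = 1" by linarith
  then show ?case by (metis one_dvd)
next
  case (Suc t)
  have *: "binomial_tower (Suc t) = binomial_tower t * (2 * 2 ^ t choose 2 ^ t)"
    by (simp add: binomial_tower_def)
  show ?case
  proof (cases "p ^ j \<le> 2 ^ t")
    case True
    then show ?thesis using Suc.IH * by simp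
  next
    case False
    then obtain i where j: "j = Suc i" by (cases j) auto
    \<comment> \<open>Removing one factor \<open>p\<close> at least halves the power, so the
      induction hypothesis covers \<open>p ^ i\<close>; the newest binomial coefficient supplies the
      missing factor.\<close>
    have "2 * p ^ i \<le> p ^ j" using prime_ge_2_nat[OF assms(1)] by (simp add: j)
    then have "p ^ i dvd binomial_tower t" using Suc by (intro Suc.IH) simp
    moreover have "p dvd (2 * 2 ^ t choose 2 ^ t)"
      by (rule prime_dvd_central_binomial[of _ _ j]) (use assms Suc False in auto)
    ultimately show ?thesis unfolding * j power_Suc2 by (rule mult_dvd_mono)
  qed
qed

text \<open>Divisibility is tested one prime at a time: the exact power of \<open>p\<close> in
  \<open>c\<close> is at most \<open>c\<close>, hence at most \<open>2 ^ t\<close>.\<close>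

lemma dvd_binomial_tower:
  assumes "1 \<le> c" "c \<le> 2 ^ t"
  shows "c dvd binomial_tower t"
proof (rule multiplicity_le_imp_dvd)
  fix p :: nat assume p: "prime p"
  have "p ^ multiplicity p c \<le> c" 
    using assms by (intro dvd_imp_le multiplicity_dvd) auto
  then have "p ^ multiplicity p c dvd binomial_tower t"
    using assms p by (intro prime_power_dvd_binomial_tower) auto
  then show "multiplicity p c \<le> multiplicity p (binomial_tower t)"
    using binomial_tower_pos[of t] p by (intro multiplicity_geI) (auto simp: prime_nat_iff)
qed (use assms in auto)

section \<open>Residual finiteness growth and isomorphisms\<close>

lemma image_r_coset_hom:
  assumes "f \<in> hom G G'" "N \<subseteq> carrier G" "x \<in> carrier G"
  shows "f ` (N #>\<^bsub>G\<^esub> x) = f ` N #>\<^bsub>G'\<^esub> f x"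
proof -
  have "f (n \<otimes>\<^bsub>G\<^esub> x) = f n \<otimes>\<^bsub>G'\<^esub> f x" if "n \<in> N" for n
    using assms that by (auto simp: hom_mult)
  then show ?thesis unfolding r_coset_def by (fastforce simp: image_iff)
qed

lemma image_rcosets_iso:
  assumes "f \<in> iso G G'" "N \<subseteq> carrier G"
  shows "rcosets\<^bsub>G'\<^esub> (f ` N) = image f ` (rcosets\<^bsub>G\<^esub> N)"
proof -
  have "f \<in> hom G G'" and c: "carrier G' = f ` carrier G"
    using assms(1) by (auto simp: iso_def bij_betw_def)
  then show ?thesis
    unfolding RCOSETS_def c using image_r_coset_hom[OF _ assms(2)] by fastforce
qed

lemma finite_index_normal_iso:
  assumes "group G" "group G'" "f \<in> iso G G'" "N \<in> finite_index_normal G"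
  shows "f ` N \<in> finite_index_normal G'"
    and "card (rcosets\<^bsub>G'\<^esub> (f ` N)) = card (rcosets\<^bsub>G\<^esub> N)"
proof -
  have N: "N \<lhd> G" "finite (rcosets\<^bsub>G\<^esub> N)" using assms(4) by (auto simp: finite_index_normal_def)
  then have sub: "N \<subseteq> carrier G" by (simp add: normal_imp_subgroup subgroup.subset)
  note rc = image_rcosets_iso[OF assms(3) sub]
  show "f ` N \<in> finite_index_normal G'"
    using iso_normal_subgroup[OF assms(3,1,2) N(1)] N(2) rc by (simp add: finite_index_normal_def)
  have "inj_on f (carrier G)" using assms(3) by (simp add: iso_def bij_betw_def)
  then have "inj_on (image f) (rcosets\<^bsub>G\<^esub> N)"
    using group.rcosets_part_G[OF assms(1) normal_imp_subgroup[OF N(1)]]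
    by (metis inj_on_image_Pow inj_on_subset Sup_upper PowI subsetI)
  then show "card (rcosets\<^bsub>G'\<^esub> (f ` N)) = card (rcosets\<^bsub>G\<^esub> N)"
    unfolding rc by (rule card_image)
qed

lemma separating_index_iso_imp:
  assumes "group G" "group G'" "f \<in> iso G G'" "g \<in> carrier G"
    and "\<exists>N \<in> finite_index_normal G. g \<notin> N \<and> d = card (rcosets\<^bsub>G\<^esub> N)"
  shows "\<exists>N \<in> finite_index_normal G'. f g \<notin> N \<and> d = card (rcosets\<^bsub>G'\<^esub> N)"
proof -
  obtain N where N: "N \<in> finite_index_normal G" "g \<notin> N" "d = card (rcosets\<^bsub>G\<^esub> N)"
    using assms(5) by blast
  have "N \<subseteq> carrier G"
    using N(1) by (simp add: finite_index_normal_def normal_imp_subgroup subgroup.subset)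
  moreover have "inj_on f (carrier G)" using assms(3) by (simp add: iso_def bij_betw_def)
  ultimately have "f g \<notin> f ` N" using N(2) assms(4) by (meson inj_on_image_mem_iff)
  then show ?thesis using finite_index_normal_iso[OF assms(1-3) N(1)] N(3) by auto
qed

text \<open>Both directions are the one-sided transfer, applied to \<open>f\<close> and to its
  inverse. As the possible separating indices agree, so do their least elements.\<close>

lemma separating_index_iso:
  assumes "group G" "group G'" "f \<in> iso G G'" "g \<in> carrier G"
  shows "(\<exists>N \<in> finite_index_normal G'. f g \<notin> N \<and> d = card (rcosets\<^bsub>G'\<^esub> N)) \<longleftrightarrow>
    (\<exists>N \<in> finite_index_normal G. g \<notin> N \<and> d = card (rcosets\<^bsub>G\<^esub> N))"
proof -
  have bij: "bij_betw f (carrier G) (carrier G')" using assms(3) by (simp add: iso_def)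
  then have "inv_into (carrier G) f (f g) = g" "f g \<in> carrier G'"
    using assms(4) by (auto simp: bij_betw_def)
  then show ?thesis
    using separating_index_iso_imp[OF assms]
      separating_index_iso_imp[OF assms(2,1) group.iso_set_sym[OF assms(1,3)], of "f g" d]
    by auto
qed

lemma divisibility_iso:
  assumes "group G" "group G'" "f \<in> iso G G'" "g \<in> carrier G"
  shows "divisibility G' (f g) = divisibility G g"
  unfolding divisibility_def separating_index_iso[OF assms] ..

lemma word_ball_subset_carrier:
  assumes "group G" "S \<subseteq> carrier G"
  shows "word_ball G S r \<subseteq> carrier G"
proof -
  interpret group G by fact
  have "foldr (\<otimes>\<^bsub>G\<^esub>) ws \<one>\<^bsub>G\<^esub> \<in> carrier G" if "set ws \<subseteq> S \<union> (\<lambda>s. inv\<^bsub>G\<^esub> s) ` S" for ws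
    using that assms(2) by (induction ws) auto
  then show ?thesis unfolding word_ball_def by auto
qed

lemma word_ball_iso_subset:
  assumes "group G" "group G'" "f \<in> iso G G'" "S \<subseteq> carrier G"
  shows "f ` word_ball G S r \<subseteq> word_ball G' (f ` S) r"
proof -
  interpret group_hom G G' f
    using assms by (auto simp: group_hom_def group_hom_axioms_def iso_def)
  show ?thesis
  proof
    fix x assume "x \<in> f ` word_ball G S r"
    then obtain ws where ws: "x = f (foldr (\<otimes>\<^bsub>G\<^esub>) ws \<one>\<^bsub>G\<^esub>)"
      "set ws \<subseteq> S \<union> (\<lambda>s. inv\<^bsub>G\<^esub> s) ` S" "real (length ws) \<le> r"
      unfolding word_ball_def by auto
    have "foldr (\<otimes>\<^bsub>G\<^esub>) us \<one>\<^bsub>G\<^esub> \<in> carrier G \<and>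
        f (foldr (\<otimes>\<^bsub>G\<^esub>) us \<one>\<^bsub>G\<^esub>) = foldr (\<otimes>\<^bsub>G'\<^esub>) (map f us) \<one>\<^bsub>G'\<^esub>"
      if "set us \<subseteq> S \<union> (\<lambda>s. inv\<^bsub>G\<^esub> s) ` S" for us
      using that assms(4) by (induction us) auto
    then have "x = foldr (\<otimes>\<^bsub>G'\<^esub>) (map f ws) \<one>\<^bsub>G'\<^esub>" using ws by blast
    moreover have "set (map f ws) \<subseteq> f ` S \<union> (\<lambda>s. inv\<^bsub>G'\<^esub> s) ` f ` S"
    proof
      fix y assume "y \<in> set (map f ws)"
      then obtain w where "w \<in> set ws" "y = f w" by auto
      then show "y \<in> f ` S \<union> (\<lambda>s. inv\<^bsub>G'\<^esub> s) ` f ` S"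
        using ws(2) assms(4) by (auto simp: subset_iff)
    qed
    ultimately show "x \<in> word_ball G' (f ` S) r"
      unfolding word_ball_def using ws(3) by (metis (mono_tags, lifting) length_map mem_Collect_eq)
  qed
qed

lemma word_ball_iso:
  assumes "group G" "group G'" "f \<in> iso G G'" "S \<subseteq> carrier G"
  shows "word_ball G' (f ` S) r = f ` word_ball G S r"
proof
  have bij: "bij_betw f (carrier G) (carrier G')" using assms(3) by (simp add: iso_def)
  let ?g = "inv_into (carrier G) f"
  have img: "f ` S \<subseteq> carrier G'" using bij assms(4) by (auto simp: bij_betw_def)
  have "?g ` f ` S = S" using bij assms(4) by (simp add: bij_betw_def inv_into_image_cancel)
  \<comment> \<open>The reverse inclusion is the forward one for the inverse isomorphism, mapped
    back by \<open>f\<close>.\<close>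
  then have "?g ` word_ball G' (f ` S) r \<subseteq> word_ball G S r"
    using word_ball_iso_subset[OF assms(2,1) group.iso_set_sym[OF assms(1,3)] img] by simp
  then have "f ` ?g ` word_ball G' (f ` S) r \<subseteq> f ` word_ball G S r" by blast
  moreover have "f ` ?g ` word_ball G' (f ` S) r = word_ball G' (f ` S) r"
    using word_ball_subset_carrier[OF assms(2) img] bij
    by (intro image_inv_into_cancel) (auto simp: bij_betw_def)
  ultimately show "word_ball G' (f ` S) r \<subseteq> f ` word_ball G S r" by simp
qed (rule word_ball_iso_subset[OF assms])

lemma RF_growth_iso:
  assumes "group G" "group G'" "f \<in> iso G G'" "S \<subseteq> carrier G"
  shows "RF_growth G' (f ` S) = RF_growth G S"
proof
  fix r
  interpret group_hom G G' f
    using assms by (auto simp: group_hom_def group_hom_axioms_def iso_def)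
  have inj: "inj_on f (carrier G)" using assms(3) by (simp add: iso_def bij_betw_def)
  note sub = word_ball_subset_carrier[OF assms(1,4), of r]
  have "word_ball G' (f ` S) r - {\<one>\<^bsub>G'\<^esub>} = f ` word_ball G S r - f ` {\<one>\<^bsub>G\<^esub>}"
    by (simp add: word_ball_iso[OF assms])
  also have "\<dots> = f ` (word_ball G S r - {\<one>\<^bsub>G\<^esub>})"
    using sub by (intro inj_on_image_set_diff[OF inj, symmetric]) auto
  finally have "divisibility G' ` (word_ball G' (f ` S) r - {\<one>\<^bsub>G'\<^esub>}) =
      divisibility G ` (word_ball G S r - {\<one>\<^bsub>G\<^esub>})"
    using sub divisibility_iso[OF assms(1-3)] by (auto simp: image_image intro!: image_cong)
  then show "RF_growth G' (f ` S) r = RF_growth G S r" by (simp add: RF_growth_def)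
qed

text \<open>This allows the final example, built from integer vectors, to be replaced by an
  isomorphic group on \<open>nat\<close>.\<close>

lemma RF_equals_iso:
  assumes "group G'" "f \<in> iso G G'" "RF_equals G F"
  shows "RF_equals G' F"
proof -
  obtain S where G: "group G" "residually_finite G"
    and S: "finite S" "generating_set G S" "growth_equiv (RF_growth G S) F"
    using assms(3) by (auto simp: RF_equals_def)
  interpret group_hom G G' f
    using assms G by (auto simp: group_hom_def group_hom_axioms_def iso_def)
  have bij: "f ` carrier G = carrier G'" "inj_on f (carrier G)"
    using assms(2) by (auto simp: iso_def bij_betw_def)
  have sub: "S \<subseteq> carrier G" "generate G S = carrier G" using S(2) by (auto simp: generating_set_def)
  have "residually_finite G'"
    unfolding residually_finite_def
  proof
    fix g' assume g': "g' \<in> carrier G' - {\<one>\<^bsub>G'\<^esub>}"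
    then obtain g where g: "g \<in> carrier G" "g' = f g" using bij(1) by blast
    then have "g \<noteq> \<one>\<^bsub>G\<^esub>" using g' by auto
    then obtain N where "N \<in> finite_index_normal G" "g \<notin> N"
      using G(2) g(1) unfolding residually_finite_def by blast
    then show "\<exists>N\<in>finite_index_normal G'. g' \<notin> N"
      using separating_index_iso_imp[OF G(1) assms(1,2) g(1)] g(2) by blast
  qed
  moreover have "generating_set G' (f ` S)"
    using sub bij generate_img[OF sub(1)] by (auto simp: generating_set_def)
  ultimately show ?thesis
    unfolding RF_equals_def
    using S assms(1) RF_growth_iso[OF G(1) assms(1,2) sub(1)] by (metis finite_imageI)
qed

lemma RF_equals_imp_finitely_generated: "RF_equals G F \<Longrightarrow> finitely_generated G"
  by (auto simp: RF_equals_def finitely_generated_def)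

section \<open>Word balls and elementary bounds for divisibility\<close>

text \<open>Finiteness is what makes \<open>Max\<close> in \<open>RF_growth\<close>
  meaningful.\<close>

lemma finite_word_ball:
  assumes "finite S"
  shows "finite (word_ball G S r)"
proof -
  have "word_ball G S r \<subseteq> (\<lambda>ws. foldr (\<otimes>\<^bsub>G\<^esub>) ws \<one>\<^bsub>G\<^esub>) `
      {ws. set ws \<subseteq> S \<union> (\<lambda>s. inv\<^bsub>G\<^esub> s) ` S \<and> length ws \<le> nat \<lfloor>r\<rfloor>}"
    unfolding word_ball_def by (auto simp: le_nat_floor)
  then show ?thesis
    by (rule finite_subset) (intro finite_imageI finite_lists_length_le finite_UnI assms)
qed

lemma divisibility_le:
  assumes "N \<in> finite_index_normal G" "g \<notin> N"
  shows "divisibility G g \<le> card (rcosets\<^bsub>G\<^esub> N)"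
  unfolding divisibility_def using assms by (intro Least_le) blast

text \<open>The existence of a separating subgroup guarantees that the value of \<open>LEAST\<close>
  is attained, so that a bound for all separating indices applies to it.\<close>

lemma divisibility_ge:
  assumes "\<exists>N \<in> finite_index_normal G. g \<notin> N"
    and "\<And>N. N \<in> finite_index_normal G \<Longrightarrow> g \<notin> N \<Longrightarrow> d \<le> card (rcosets\<^bsub>G\<^esub> N)"
  shows "d \<le> divisibility G g"
proof -
  have "\<exists>N \<in> finite_index_normal G. g \<notin> N \<and> divisibility G g = card (rcosets\<^bsub>G\<^esub> N)"
    unfolding divisibility_def by (rule LeastI_ex) (use assms(1) in blast)
  then show ?thesis using assms(2) by auto
qed

lemma divisibility_le_RF_growth:
  assumes "finite S" "g \<in> word_ball G S r" "g \<noteq> \<one>\<^bsub>G\<^esub>"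
  shows "real (divisibility G g) \<le> RF_growth G S r"
  unfolding RF_growth_def of_nat_le_iff
  using assms by (intro Max_ge finite_imageI finite_Diff finite_word_ball) auto

text \<open>The witness \<open>g\<close> makes the set under \<open>Max\<close> nonempty, so the
  maximum is one of the bounded values.\<close>

lemma RF_growth_le:
  assumes "finite S" "g \<in> word_ball G S r" "g \<noteq> \<one>\<^bsub>G\<^esub>"
    and "\<And>g. g \<in> word_ball G S r \<Longrightarrow> g \<noteq> \<one>\<^bsub>G\<^esub> \<Longrightarrow> real (divisibility G g) \<le> b"
  shows "RF_growth G S r \<le> b"
proof -
  have "Max (divisibility G ` (word_ball G S r - {\<one>\<^bsub>G\<^esub>})) \<in>
      divisibility G ` (word_ball G S r - {\<one>\<^bsub>G\<^esub>})"
    using assms(1-3) by (intro Max_in finite_imageI finite_Diff finite_word_ball) auto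
  then show ?thesis unfolding RF_growth_def using assms(4) by fastforce
qed

section \<open>Integer orthogonal matrices\<close>

lemma finite_mat_entries:
  assumes "finite X"
  shows "finite {A \<in> carrier_mat m n. \<forall>i<m. \<forall>j<n. A $$ (i, j) \<in> X}"
proof -
  have "{A \<in> carrier_mat m n. \<forall>i<m. \<forall>j<n. A $$ (i, j) \<in> X} \<subseteq>
      mat m n ` (PiE ({..<m} \<times> {..<n}) (\<lambda>_. X))"
  proof
    fix A assume "A \<in> {A \<in> carrier_mat m n. \<forall>i<m. \<forall>j<n. A $$ (i, j) \<in> X}"
    then have "A = mat m n (restrict (($$) A) ({..<m} \<times> {..<n}))"
      "restrict (($$) A) ({..<m} \<times> {..<n}) \<in> PiE ({..<m} \<times> {..<n}) (\<lambda>_. X)"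
      by auto
    then show "A \<in> mat m n ` (PiE ({..<m} \<times> {..<n}) (\<lambda>_. X))" by (rule image_eqI)
  qed
  then show ?thesis by (rule finite_subset) (intro finite_imageI finite_PiE; simp add: assms)
qed

text \<open>An integer orthogonal matrix is a signed permutation matrix, so this is the hyperoctahedral
  group of the first \<open>k\<close> coordinates.\<close>

definition orthogonal_fixing :: "nat \<Rightarrow> nat \<Rightarrow> int mat set" where
  "orthogonal_fixing m k = {A \<in> carrier_mat m m. A * A\<^sup>T = 1\<^sub>m m \<and> A\<^sup>T * A = 1\<^sub>m m \<and>
     (\<forall>j. k \<le> j \<and> j < m \<longrightarrow> A *\<^sub>v unit_vec m j = unit_vec m j)}"

lemma orthogonal_fixing_one: "1\<^sub>m m \<in> orthogonal_fixing m k"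
  by (auto simp: orthogonal_fixing_def)

text \<open>The transpose is the inverse and therefore fixes the same unit vectors.\<close>

lemma orthogonal_fixing_transpose:
  assumes "A \<in> orthogonal_fixing m k"
  shows "A\<^sup>T \<in> orthogonal_fixing m k"
proof -
  have A: "A \<in> carrier_mat m m" "A * A\<^sup>T = 1\<^sub>m m" "A\<^sup>T * A = 1\<^sub>m m"
    "\<And>j. k \<le> j \<Longrightarrow> j < m \<Longrightarrow> A *\<^sub>v unit_vec m j = unit_vec m j"
    using assms by (auto simp: orthogonal_fixing_def)
  have "A\<^sup>T *\<^sub>v unit_vec m j = unit_vec m j" if "k \<le> j" "j < m" for j
  proof -
    have "A\<^sup>T *\<^sub>v (A *\<^sub>v unit_vec m j) = (A\<^sup>T * A) *\<^sub>v unit_vec m j"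
      using A(1) by (intro assoc_mult_mat_vec[symmetric]) auto
    then show ?thesis using A that by simp
  qed
  then show ?thesis using A by (auto simp: orthogonal_fixing_def)
qed

lemma orthogonal_fixing_mult:
  assumes "A \<in> orthogonal_fixing m k" "B \<in> orthogonal_fixing m k"
  shows "A * B \<in> orthogonal_fixing m k"
proof -
  have A: "A \<in> carrier_mat m m" "A * A\<^sup>T = 1\<^sub>m m" "A\<^sup>T * A = 1\<^sub>m m"
    "\<And>j. k \<le> j \<Longrightarrow> j < m \<Longrightarrow> A *\<^sub>v unit_vec m j = unit_vec m j"
    using assms by (auto simp: orthogonal_fixing_def)
  have B: "B \<in> carrier_mat m m" "B * B\<^sup>T = 1\<^sub>m m" "B\<^sup>T * B = 1\<^sub>m m"
    "\<And>j. k \<le> j \<Longrightarrow> j < m \<Longrightarrow> B *\<^sub>v unit_vec m j = unit_vec m j"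
    using assms by (auto simp: orthogonal_fixing_def)
  note T = A(1) B(1) A(1)[THEN transpose_carrier_mat[THEN iffD2]] B(1)[THEN transpose_carrier_mat[THEN iffD2]]
  have t: "(A * B)\<^sup>T = B\<^sup>T * A\<^sup>T" using A B by (intro transpose_mult) auto
  have "(A * B) * (B\<^sup>T * A\<^sup>T) = A * ((B * B\<^sup>T) * A\<^sup>T)"
    using T by (simp add: assoc_mult_mat[of _ m m _ m _ m])
  then have 1: "(A * B) * (A * B)\<^sup>T = 1\<^sub>m m" unfolding t B(2) using A T by simp
  have "(B\<^sup>T * A\<^sup>T) * (A * B) = B\<^sup>T * ((A\<^sup>T * A) * B)"
    using T by (simp add: assoc_mult_mat[of _ m m _ m _ m])
  then have 2: "(A * B)\<^sup>T * (A * B) = 1\<^sub>m m" unfolding t A(3) using B T by simp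
  have "(A * B) *\<^sub>v unit_vec m j = unit_vec m j" if "k \<le> j" "j < m" for j
    using that A B by (simp add: assoc_mult_mat_vec[of _ m m _ m])
  then show ?thesis using 1 2 T by (auto simp: orthogonal_fixing_def)
qed

lemma square_le_scalar_prod_self:
  fixes v :: "int vec"
  assumes "v \<in> carrier_vec m" "i < m"
  shows "(v $ i)\<^sup>2 \<le> v \<bullet> v"
proof -
  have "v \<bullet> v = (\<Sum>j<m. (v $ j)\<^sup>2)"
    using assms(1) by (auto simp: scalar_prod_def power2_eq_square lessThan_atLeast0)
  also have "(v $ i)\<^sup>2 \<le> \<dots>" using assms(2) by (intro member_le_sum) auto
  finally show ?thesis .
qed

text \<open>The rows have norm one, so all entries lie in \<open>{-1, 0, 1}\<close>.\<close>

lemma finite_orthogonal_fixing: "finite (orthogonal_fixing m k)"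
proof (rule finite_subset)
  show "orthogonal_fixing m k \<subseteq> {A \<in> carrier_mat m m. \<forall>i<m. \<forall>j<m. A $$ (i, j) \<in> {-1..1}}"
  proof (intro subsetI CollectI conjI allI impI)
    fix A i j assume A: "A \<in> orthogonal_fixing m k" and ij: "i < m" "j < m"
    then have c: "A \<in> carrier_mat m m" and "(A * A\<^sup>T) $$ (i, i) = 1"
      by (auto simp: orthogonal_fixing_def)
    then have "row A i \<bullet> row A i = 1" using ij by auto
    then have "(A $$ (i, j))\<^sup>2 \<le> 1"
      using square_le_scalar_prod_self[of "row A i" m j] c ij by auto
    then show "A $$ (i, j) \<in> {-1..1}" by (auto simp: abs_square_le_1 abs_le_iff)
  qed (auto simp: orthogonal_fixing_def)
qed (rule finite_mat_entries, simp)

text \<open>This invariance is why word lengths are compared with the Euclidean norm: letters from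
  the finite group do not lengthen a vector.\<close>

lemma orthogonal_fixing_norm:
  assumes "A \<in> orthogonal_fixing m k" "v \<in> carrier_vec m"
  shows "(A *\<^sub>v v) \<bullet> (A *\<^sub>v v) = v \<bullet> v"
proof -
  have A: "A \<in> carrier_mat m m" "A\<^sup>T * A = 1\<^sub>m m"
    using assms by (auto simp: orthogonal_fixing_def)
  have "(A *\<^sub>v v) \<bullet> (A *\<^sub>v v) = (A\<^sup>T *\<^sub>v (A *\<^sub>v v)) \<bullet> v"
    using A assms(2) by (intro transpose_vec_mult_scalar[symmetric]) auto
  also have "A\<^sup>T *\<^sub>v (A *\<^sub>v v) = (A\<^sup>T * A) *\<^sub>v v"
    using A(1) assms(2) by (intro assoc_mult_mat_vec[symmetric]) auto
  finally show ?thesis using A(2) assms(2) by simp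
qed

text \<open>The transpose fixes \<open>unit_vec m i\<close> as well, and pairing with that vector
  reads off the coordinate.\<close>

lemma orthogonal_fixing_coord:
  assumes A: "A \<in> orthogonal_fixing m k" and "v \<in> carrier_vec m" "k \<le> i" "i < m"
  shows "(A *\<^sub>v v) $ i = v $ i"
proof -
  have T: "A \<in> carrier_mat m m" "A\<^sup>T *\<^sub>v unit_vec m i = unit_vec m i"
    using A orthogonal_fixing_transpose[OF A] assms by (auto simp: orthogonal_fixing_def)
  have "(A *\<^sub>v v) $ i = unit_vec m i \<bullet> (A *\<^sub>v v)"
    using T(1) assms by (intro scalar_prod_left_unit[symmetric]) auto
  also have "\<dots> = (A\<^sup>T *\<^sub>v unit_vec m i) \<bullet> v"
    using T(1) assms by (intro transpose_vec_mult_scalar[symmetric]) auto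
  finally show ?thesis using T(2) assms by simp
qed

lemma orthogonal_fixing_block:
  assumes A: "A \<in> orthogonal_fixing m k" and "i < k" "k \<le> j" "j < m"
  shows "A $$ (i, j) = 0"
proof -
  have T: "A \<in> carrier_mat m m" "A *\<^sub>v unit_vec m j = unit_vec m j"
    using A assms by (auto simp: orthogonal_fixing_def)
  have "A $$ (i, j) = (A *\<^sub>v unit_vec m j) $ i"
    using T(1) assms by simp
  also have "\<dots> = 0" unfolding T(2) using assms by simp
  finally show ?thesis .
qed

text \<open>Coordinates outside the first block enter row \<open>i\<close> with coefficient zero, so
  congruence conditions on the block are invariant.\<close>

lemma orthogonal_fixing_dvd:
  assumes A: "A \<in> orthogonal_fixing m k" and v: "v \<in> carrier_vec m" "k \<le> m"
    and dvd: "\<And>j. j < k \<Longrightarrow> c dvd v $ j" and i: "i < k"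
  shows "c dvd (A *\<^sub>v v) $ i"
proof -
  have "A \<in> carrier_mat m m" using A by (auto simp: orthogonal_fixing_def)
  then have "(A *\<^sub>v v) $ i = (\<Sum>j<m. A $$ (i, j) * v $ j)"
    using v i by (auto simp: scalar_prod_def lessThan_atLeast0)
  also have "c dvd \<dots>"
  proof (rule dvd_sum)
    fix j assume "j \<in> {..<m}"
    then show "c dvd A $$ (i, j) * v $ j"
      using orthogonal_fixing_block[OF A i] dvd by (cases "j < k") auto
  qed
  finally show ?thesis .
qed

section \<open>Signed permutation matrices given by involutions\<close>

text \<open>One form for both kinds of matrices used below: sign changes have
  \<open>\<sigma> = id\<close>, transpositions have all signs \<open>1\<close>.\<close>

definition signed_involution :: "nat \<Rightarrow> (nat \<Rightarrow> nat) \<Rightarrow> (nat \<Rightarrow> int) \<Rightarrow> int mat" where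
  "signed_involution m \<sigma> s = mat m m (\<lambda>(i, j). if j = \<sigma> i then s i else 0)"

lemma dim_row_signed_involution [simp]: "dim_row (signed_involution m \<sigma> s) = m"
  by (simp add: signed_involution_def)

lemma signed_involution_mult_vec:
  assumes "v \<in> carrier_vec m" "\<And>i. i < m \<Longrightarrow> \<sigma> i < m" "i < m"
  shows "(signed_involution m \<sigma> s *\<^sub>v v) $ i = s i * v $ \<sigma> i"
proof -
  have "(signed_involution m \<sigma> s *\<^sub>v v) $ i = (\<Sum>j\<in>{0..<m}. (if j = \<sigma> i then s i else 0) * v $ j)"
    using assms by (simp add: signed_involution_def scalar_prod_def)
  also have "\<dots> = (\<Sum>j\<in>{0..<m}. if j = \<sigma> i then s i * v $ j else 0)"
    by (intro sum.cong) auto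
  also have "\<dots> = s i * v $ \<sigma> i" using assms by (simp add: sum.delta)
  finally show ?thesis .
qed

text \<open>Since \<open>\<sigma>\<close> is an involution and \<open>s\<close> is constant on its
  orbits, the matrix is symmetric; both orthogonality relations then say that its square is the
  identity.\<close>

lemma signed_involution_orthogonal:
  assumes "\<And>i. i < m \<Longrightarrow> \<sigma> i < m \<and> \<sigma> (\<sigma> i) = i \<and> s (\<sigma> i) = s i \<and> s i * s i = 1"
    and "\<And>j. k \<le> j \<Longrightarrow> j < m \<Longrightarrow> \<sigma> j = j \<and> s j = 1"
  shows "signed_involution m \<sigma> s \<in> orthogonal_fixing m k"
proof -
  let ?A = "signed_involution m \<sigma> s"
  have c: "?A \<in> carrier_mat m m" by (simp add: signed_involution_def)
  have sym: "?A\<^sup>T = ?A"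
  proof (rule eq_matI)
    fix i j assume "i < dim_row ?A" "j < dim_col ?A"
    then have "i < m" "j < m" using c by auto
    then show "?A\<^sup>T $$ (i, j) = ?A $$ (i, j)"
      using assms(1)[of i] assms(1)[of j] by (auto simp: signed_involution_def)
  qed (use c in auto)
  have sq: "?A * ?A = 1\<^sub>m m"
  proof (rule eq_matI)
    fix i j assume "i < dim_row (1\<^sub>m m :: int mat)" "j < dim_col (1\<^sub>m m :: int mat)"
    then have ij: "i < m" "j < m" by auto
    have "(?A * ?A) $$ (i, j) = (?A *\<^sub>v col ?A j) $ i"
      using c ij by simp
    also have "\<dots> = s i * col ?A j $ \<sigma> i"
      using c ij assms(1) by (intro signed_involution_mult_vec) auto
    also have "\<dots> = (if i = j then 1 else 0)"
      using ij assms(1)[of i] by (auto simp: signed_involution_def)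
    finally show "(?A * ?A) $$ (i, j) = 1\<^sub>m m $$ (i, j)" using ij by simp
  qed (use c in auto)
  have "?A *\<^sub>v unit_vec m j = unit_vec m j" if j: "k \<le> j" "j < m" for j
  proof (rule eq_vecI)
    fix i assume "i < dim_vec (unit_vec m j :: int vec)"
    then have i: "i < m" by simp
    then have "(?A *\<^sub>v unit_vec m j) $ i = s i * unit_vec m j $ \<sigma> i"
      using assms(1) by (intro signed_involution_mult_vec) auto
    also have "\<sigma> i = j \<longleftrightarrow> i = j" using assms(1)[OF i] assms(2)[OF j] by metis
    then have "s i * unit_vec m j $ \<sigma> i = (unit_vec m j $ i :: int)"
      using assms(1)[OF i] assms(2)[OF j] i j by auto
    finally show "(?A *\<^sub>v unit_vec m j) $ i = unit_vec m j $ i" .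
  qed (use c in simp)
  then show ?thesis using c sq by (auto simp: orthogonal_fixing_def sym)
qed

section \<open>The semidirect product\<close>

text \<open>On \<open>X\<close> the map \<open>g\<close> factors through \<open>f\<close>. It is
  used to bound an index, with \<open>g\<close> sending an element to its coset and \<open>f\<close>
  recording residues.\<close>

lemma card_image_le_of_factor:
  assumes "finite T" "f ` X \<subseteq> T" "\<And>x y. x \<in> X \<Longrightarrow> y \<in> X \<Longrightarrow> f x = f y \<Longrightarrow> g x = g y"
  shows "finite (g ` X)" "card (g ` X) \<le> card T"
proof -
  have *: "g ` X = (\<lambda>t. g (SOME x. x \<in> X \<and> f x = t)) ` f ` X"
  proof -
    have "g (SOME y. y \<in> X \<and> f y = f x) = g x" if "x \<in> X" for x
    proof -
      have "(SOME y. y \<in> X \<and> f y = f x) \<in> X \<and> f (SOME y. y \<in> X \<and> f y = f x) = f x"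
        by (rule someI[of _ x]) (use that in auto)
      then show ?thesis using assms(3) that by blast
    qed
    then show ?thesis by (simp add: image_image cong: image_cong)
  qed
  have fin: "finite (f ` X)" using assms(1,2) by (rule finite_subset[rotated])
  then show "finite (g ` X)" unfolding * by simp
  show "card (g ` X) \<le> card T"
    unfolding * using card_image_le[OF fin] card_mono[OF assms(1,2)] order_trans by blast
qed

lemma group_GL_int: "group (GL_int m)"
proof -
  interpret ring "ring_mat TYPE(int) m ()" by (rule ring_mat)
  show ?thesis unfolding GL_int_def by (rule units_group)
qed

lemma GL_int_simps:
  "carrier (GL_int m) = Units (ring_mat TYPE(int) m ())"
  "x \<otimes>\<^bsub>GL_int m\<^esub> y = x * y" "\<one>\<^bsub>GL_int m\<^esub> = 1\<^sub>m m"
  by (auto simp: GL_int_def units_of_def ring_mat_simps)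

lemma orthogonal_fixing_subset_GL_int: "orthogonal_fixing m k \<subseteq> carrier (GL_int m)"
proof
  fix A assume "A \<in> orthogonal_fixing m k"
  then have "A \<in> carrier_mat m m" "A\<^sup>T \<in> carrier_mat m m" "A * A\<^sup>T = 1\<^sub>m m" "A\<^sup>T * A = 1\<^sub>m m"
    by (auto simp: orthogonal_fixing_def)
  then show "A \<in> carrier (GL_int m)"
    unfolding GL_int_simps Units_def by (auto simp: ring_mat_simps)
qed

text \<open>Only the image of \<open>\<phi>\<close> is prescribed, so \<open>H\<close> may be an
  abstract copy of the matrix group on any type, such as \<open>nat\<close>.\<close>

locale orthogonal_semidirect = H: group H
  for H :: "('b, 'd) monoid_scheme" (structure) +
  fixes m k :: nat and \<phi> :: "'b \<Rightarrow> int mat"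
  assumes k: "1 \<le> k" "k \<le> m"
    and finite_H: "finite (carrier H)"
    and hom: "\<phi> \<in> hom H (GL_int m)"
    and image: "\<phi> ` carrier H = orthogonal_fixing m k"
begin

abbreviation G where "G \<equiv> lattice_semidirect m H \<phi>"

lemma G_simps:
  "carrier G = carrier_vec m \<times> carrier H"
  "\<one>\<^bsub>G\<^esub> = (0\<^sub>v m, \<one>\<^bsub>H\<^esub>)"
  "(u, h) \<otimes>\<^bsub>G\<^esub> (v, h') = (u + \<phi> h *\<^sub>v v, h \<otimes>\<^bsub>H\<^esub> h')"
  by (simp_all add: lattice_semidirect_def semidirect_product_def monoid_vec_simps)

lemma phi_orthogonal: "h \<in> carrier H \<Longrightarrow> \<phi> h \<in> orthogonal_fixing m k"
  using image by blast

lemma phi_carrier: "h \<in> carrier H \<Longrightarrow> \<phi> h \<in> carrier_mat m m"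
  using phi_orthogonal by (auto simp: orthogonal_fixing_def)

lemma phi_vec_carrier: "h \<in> carrier H \<Longrightarrow> v \<in> carrier_vec m \<Longrightarrow> \<phi> h *\<^sub>v v \<in> carrier_vec m"
  using phi_carrier by (metis mult_mat_vec_carrier)

lemma phi_one: "\<phi> \<one>\<^bsub>H\<^esub> = 1\<^sub>m m"
proof -
  interpret group_hom H "GL_int m" \<phi>
    using hom group_GL_int H.group_axioms by (simp add: group_hom_def group_hom_axioms_def)
  show ?thesis using hom_one by (simp add: GL_int_simps)
qed

lemma phi_mult:
  "h \<in> carrier H \<Longrightarrow> h' \<in> carrier H \<Longrightarrow> v \<in> carrier_vec m \<Longrightarrow>
    \<phi> (h \<otimes>\<^bsub>H\<^esub> h') *\<^sub>v v = \<phi> h *\<^sub>v (\<phi> h' *\<^sub>v v)"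
  using hom_mult[OF hom] phi_carrier by (simp add: GL_int_simps assoc_mult_mat_vec[of _ m m _ m])

lemma phi_add:
  "h \<in> carrier H \<Longrightarrow> u \<in> carrier_vec m \<Longrightarrow> v \<in> carrier_vec m \<Longrightarrow>
    \<phi> h *\<^sub>v (u + v) = \<phi> h *\<^sub>v u + \<phi> h *\<^sub>v v"
  using phi_carrier by (intro mult_add_distrib_mat_vec) auto

lemma phi_zero: "h \<in> carrier H \<Longrightarrow> \<phi> h *\<^sub>v 0\<^sub>v m = 0\<^sub>v m"
  using phi_carrier[of h] by (intro eq_vecI) auto

lemma group_G: "group G"
proof (rule groupI)
  fix x y z assume "x \<in> carrier G" "y \<in> carrier G" "z \<in> carrier G"
  then show "x \<otimes>\<^bsub>G\<^esub> y \<otimes>\<^bsub>G\<^esub> z = x \<otimes>\<^bsub>G\<^esub> (y \<otimes>\<^bsub>G\<^esub> z)"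
    by (auto simp: G_simps phi_mult phi_add phi_vec_carrier H.m_assoc assoc_add_vec[of _ m])
next
  fix x assume "x \<in> carrier G"
  then obtain v h where x: "x = (v, h)" "v \<in> carrier_vec m" "h \<in> carrier H" by (auto simp: G_simps)
  \<comment> \<open>A left inverse suffices for \<open>groupI\<close>; its translation part is
    chosen to cancel \<open>\<phi> (inv h)\<close> applied to \<open>v\<close>.\<close>
  have "(- (\<phi> (inv h) *\<^sub>v v), inv h) \<otimes>\<^bsub>G\<^esub> x = \<one>\<^bsub>G\<^esub>"
    using x by (simp add: G_simps phi_vec_carrier uminus_l_inv_vec[of _ m])
  moreover have "(- (\<phi> (inv h) *\<^sub>v v), inv h) \<in> carrier G"
    using x by (simp add: G_simps phi_vec_carrier)
  ultimately show "\<exists>y\<in>carrier G. y \<otimes>\<^bsub>G\<^esub> x = \<one>\<^bsub>G\<^esub>" by blast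
qed (auto simp: G_simps phi_one phi_vec_carrier)

sublocale G: group G by (rule group_G)

lemma translation_mult:
  "v \<in> carrier_vec m \<Longrightarrow> h \<in> carrier H \<Longrightarrow> (u, \<one>) \<otimes>\<^bsub>G\<^esub> (v, h) = (u + v, h)"
  by (simp add: G_simps phi_one)

lemma translation_inv: "v \<in> carrier_vec m \<Longrightarrow> inv\<^bsub>G\<^esub> (v, \<one>) = (- v, \<one>)"
  by (rule G.inv_equality) (auto simp: G_simps phi_one)

lemma rotation_inv: "h \<in> carrier H \<Longrightarrow> inv\<^bsub>G\<^esub> (0\<^sub>v m, h) = (0\<^sub>v m, inv h)"
  by (rule G.inv_equality) (auto simp: G_simps phi_zero)

text \<open>The lattice is abelian, so conjugation of a translation sees only the component
  \<open>h\<close>. Normality thus becomes invariance under the matrices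
  \<open>\<phi> h\<close>.\<close>

lemma conj_translation:
  assumes "v \<in> carrier_vec m" "h \<in> carrier H" "w \<in> carrier_vec m"
  shows "(v, h) \<otimes>\<^bsub>G\<^esub> (w, \<one>) \<otimes>\<^bsub>G\<^esub> inv\<^bsub>G\<^esub> (v, h) = (\<phi> h *\<^sub>v w, \<one>)"
proof -
  have c: "(v, h) \<in> carrier G" "(w, \<one>) \<in> carrier G" "(\<phi> h *\<^sub>v w, \<one>) \<in> carrier G"
    using assms by (auto simp: G_simps phi_vec_carrier)
  have "(v, h) \<otimes>\<^bsub>G\<^esub> (w, \<one>) = (\<phi> h *\<^sub>v w, \<one>) \<otimes>\<^bsub>G\<^esub> (v, h)"
    using assms by (simp add: G_simps phi_one comm_add_vec[of _ m] phi_vec_carrier)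
  then show ?thesis using c by (simp add: G.m_assoc)
qed

section \<open>Congruence subgroups and small separating quotients\<close>

text \<open>The set \<open>I\<close> of tested coordinates lets one definition serve three
  quotients: \<open>{}\<close> gives the whole lattice, \<open>{..<k}\<close> tests the first block,
  \<open>{i}\<close> a single fixed coordinate.\<close>

definition congruence_subgroup :: "nat set \<Rightarrow> nat \<Rightarrow> (int vec \<times> 'b) set" where
  "congruence_subgroup I c = {v \<in> carrier_vec m. \<forall>j\<in>I. int c dvd v $ j} \<times> {\<one>}"

lemma congruence_subgroup_index:
  assumes I: "I \<subseteq> {..<m}" and c: "1 \<le> c"
    and inv: "\<And>h v. h \<in> carrier H \<Longrightarrow> v \<in> carrier_vec m \<Longrightarrow> \<forall>j\<in>I. int c dvd v $ j \<Longrightarrow>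
      \<forall>j\<in>I. int c dvd (\<phi> h *\<^sub>v v) $ j"
  shows "congruence_subgroup I c \<in> finite_index_normal G"
    and "card (rcosets\<^bsub>G\<^esub> (congruence_subgroup I c)) \<le> c ^ card I * card (carrier H)"
proof -
  let ?N = "congruence_subgroup I c"
  have sub: "subgroup ?N G"
  proof (rule G.subgroupI)
    show "?N \<subseteq> carrier G" by (auto simp: congruence_subgroup_def G_simps)
    show "?N \<noteq> {}" using I by (auto simp: congruence_subgroup_def subset_iff intro!: exI[of _ "0\<^sub>v m"])
    show "inv\<^bsub>G\<^esub> x \<in> ?N" if "x \<in> ?N" for x
      using that I by (auto simp: congruence_subgroup_def translation_inv subset_iff)
    show "x \<otimes>\<^bsub>G\<^esub> y \<in> ?N" if "x \<in> ?N" "y \<in> ?N" for x y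
      using that I by (auto simp: congruence_subgroup_def translation_mult subset_iff)
  qed
  have normal: "?N \<lhd> G"
    unfolding G.normal_inv_iff
  proof (intro conjI sub ballI)
    fix x n assume "x \<in> carrier G" "n \<in> ?N"
    then show "x \<otimes>\<^bsub>G\<^esub> n \<otimes>\<^bsub>G\<^esub> inv\<^bsub>G\<^esub> x \<in> ?N"
      using inv by (auto simp: congruence_subgroup_def G_simps(1) conj_translation phi_vec_carrier)
  qed
  let ?f = "\<lambda>(v, h). (restrict (\<lambda>j. v $ j mod int c) I, h)"
  let ?T = "PiE I (\<lambda>_. {0..<int c}) \<times> carrier H"
  have finI: "finite I" using I finite_subset by blast
  have rc: "rcosets\<^bsub>G\<^esub> ?N = (\<lambda>x. ?N #>\<^bsub>G\<^esub> x) ` carrier G"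
    unfolding RCOSETS_def by auto
  have T: "finite ?T" using finite_H finI by (auto intro!: finite_PiE)
  have fT: "?f ` carrier G \<subseteq> ?T" using c by (auto simp: G_simps)
  have fac: "?N #>\<^bsub>G\<^esub> x = ?N #>\<^bsub>G\<^esub> y" if xyG: "x \<in> carrier G" "y \<in> carrier G" and f: "?f x = ?f y" for x y
  proof -
    obtain v h w h' where xy: "x = (v, h)" "y = (w, h')" "v \<in> carrier_vec m" "w \<in> carrier_vec m"
      "h \<in> carrier H" "h' \<in> carrier H"
      using xyG by (cases x, cases y) (auto simp: G_simps)
    have "h = h'" and r: "restrict (\<lambda>j. v $ j mod int c) I = restrict (\<lambda>j. w $ j mod int c) I"
      using f xy by auto
    have "int c dvd (v - w) $ j" if "j \<in> I" for j
      using fun_cong[OF r, of j] that xy I by (auto simp: mod_eq_dvd_iff subset_iff)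
    then have "(v - w, \<one>) \<in> ?N" using xy by (auto simp: congruence_subgroup_def)
    moreover have "x = (v - w, \<one>) \<otimes>\<^bsub>G\<^esub> y"
      using xy \<open>h = h'\<close> by (auto simp: translation_mult)
    ultimately have "x \<in> ?N #>\<^bsub>G\<^esub> y" unfolding r_coset_def by blast
    then show ?thesis using G.repr_independence[OF _ xyG(2) sub] by simp
  qed
  show "?N \<in> finite_index_normal G"
    using card_image_le_of_factor(1)[OF T fT fac] normal
    by (simp add: finite_index_normal_def rc)
  have "card ?T = c ^ card I * card (carrier H)"
    using finI by (simp add: card_cartesian_product card_PiE)
  then show "card (rcosets\<^bsub>G\<^esub> ?N) \<le> c ^ card I * card (carrier H)"
    unfolding rc using card_image_le_of_factor(2)[OF T fT fac] by simp
qed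

text \<open>The subgroup is the whole lattice.\<close>

lemma rotation_separated:
  assumes "(v, h) \<in> carrier G" "h \<noteq> \<one>"
  shows "\<exists>N\<in>finite_index_normal G. (v, h) \<notin> N \<and> card (rcosets\<^bsub>G\<^esub> N) \<le> card (carrier H)"
proof (intro bexI conjI)
  show "congruence_subgroup {} 1 \<in> finite_index_normal G"
    by (rule congruence_subgroup_index) simp_all
  show "card (rcosets\<^bsub>G\<^esub> (congruence_subgroup {} 1)) \<le> card (carrier H)"
    using congruence_subgroup_index(2)[of "{}" 1] by simp
qed (use assms in \<open>simp add: congruence_subgroup_def\<close>)

text \<open>Inside the block the group mixes coordinates, so all \<open>k\<close> of them are
  reduced, at cost \<open>c ^ k\<close>. A fixed coordinate can be reduced alone, at cost
  \<open>c \<le> c ^ k\<close>.\<close>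

lemma translation_separated:
  assumes v: "v \<in> carrier_vec m" and i: "i < m" and c: "1 \<le> c" "\<not> int c dvd v $ i"
  shows "\<exists>N\<in>finite_index_normal G. (v, \<one>) \<notin> N \<and> card (rcosets\<^bsub>G\<^esub> N) \<le> c ^ k * card (carrier H)"
proof (cases "i < k")
  case True
  have "\<forall>j\<in>{..<k}. int c dvd (\<phi> h *\<^sub>v w) $ j"
    if "h \<in> carrier H" "w \<in> carrier_vec m" "\<forall>j\<in>{..<k}. int c dvd w $ j" for h w
    using orthogonal_fixing_dvd[OF phi_orthogonal[OF that(1)] that(2) k(2)] that(3) by auto
  moreover have "{..<k} \<subseteq> {..<m}" using k by auto
  ultimately have index: "congruence_subgroup {..<k} c \<in> finite_index_normal G"
    "card (rcosets\<^bsub>G\<^esub> (congruence_subgroup {..<k} c)) \<le> c ^ card {..<k} * card (carrier H)"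
    using congruence_subgroup_index[OF _ c(1), of "{..<k}"] by blast+
  have "(v, \<one>) \<notin> congruence_subgroup {..<k} c" using True c(2) by (auto simp: congruence_subgroup_def)
  then show ?thesis using index by auto
next
  case False
  have "\<forall>j\<in>{i}. int c dvd (\<phi> h *\<^sub>v w) $ j"
    if "h \<in> carrier H" "w \<in> carrier_vec m" "\<forall>j\<in>{i}. int c dvd w $ j" for h w
    using orthogonal_fixing_coord[OF phi_orthogonal[OF that(1)] that(2)] that(3) False i by auto
  then have index: "congruence_subgroup {i} c \<in> finite_index_normal G"
    "card (rcosets\<^bsub>G\<^esub> (congruence_subgroup {i} c)) \<le> c ^ card {i} * card (carrier H)"
    using congruence_subgroup_index[OF _ c(1), of "{i}"] i by blast+
  have "c ^ 1 \<le> c ^ k" using k c(1) by (intro power_increasing) auto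
  then have "c ^ card {i} * card (carrier H) \<le> c ^ k * card (carrier H)" by simp
  moreover have "(v, \<one>) \<notin> congruence_subgroup {i} c" using c(2) by (auto simp: congruence_subgroup_def)
  ultimately show ?thesis using index order_trans by blast
qed

section \<open>Lower bounds for the index of a normal subgroup\<close>

lemma normal_translations_doubled:
  assumes N: "N \<lhd> G" and w: "w \<in> carrier_vec m" "(w, \<one>) \<in> N" and i: "i < k"
  shows "((2 * w $ i) \<cdot>\<^sub>v unit_vec m 0, \<one>) \<in> N"
proof -
  have sub: "subgroup N G" using N by (rule normal_imp_subgroup)
  have act: "(A *\<^sub>v u, \<one>) \<in> N" if A: "A \<in> orthogonal_fixing m k" and u: "u \<in> carrier_vec m" "(u, \<one>) \<in> N" for A u
  proof -
    obtain h where h: "h \<in> carrier H" "A = \<phi> h" using A image by blast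
    then have "(0\<^sub>v m, h) \<in> carrier G" by (simp add: G_simps)
    then have "(0\<^sub>v m, h) \<otimes>\<^bsub>G\<^esub> (u, \<one>) \<otimes>\<^bsub>G\<^esub> inv\<^bsub>G\<^esub> (0\<^sub>v m, h) \<in> N"
      using N u(2) unfolding G.normal_inv_iff by blast
    then show ?thesis using h u by (simp add: conj_translation)
  qed
  \<comment> \<open>\<open>?D\<close> negates coordinate \<open>i\<close>, and \<open>?P\<close>
    exchanges the coordinates \<open>0\<close> and \<open>i\<close>.\<close>
  let ?D = "signed_involution m id (\<lambda>j. if j = i then -1 else 1)"
  let ?P = "signed_involution m (\<lambda>j. if j = 0 then i else if j = i then 0 else j) (\<lambda>_. 1)"
  have D: "?D \<in> orthogonal_fixing m k" and P: "?P \<in> orthogonal_fixing m k"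
    using i k by (auto intro!: signed_involution_orthogonal)
  \<comment> \<open>Subtracting the reflected vector cancels every coordinate except the
    \<open>i\<close>-th, which doubles; \<open>?P\<close> then carries it to the first axis.\<close>
  define u where "u = w + - (?D *\<^sub>v w)"
  have Dw: "?D *\<^sub>v w \<in> carrier_vec m" by (intro carrier_vecI) simp
  have "(- (?D *\<^sub>v w), \<one>) \<in> N"
    using subgroup.m_inv_closed[OF sub act[OF D w]] Dw by (simp add: translation_inv)
  then have u: "(u, \<one>) \<in> N"
    using subgroup.m_closed[OF sub w(2)] translation_mult[of "- (?D *\<^sub>v w)" \<one> w] Dw
    unfolding u_def by (metis uminus_carrier_vec H.one_closed)
  have uc: "u \<in> carrier_vec m" using w Dw by (simp add: u_def)
  have uj: "u $ j = (if j = i then 2 * w $ i else 0)" if "j < m" for j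
    using that w Dw signed_involution_mult_vec[OF w(1), of id j] by (simp add: u_def)
  have "?P *\<^sub>v u = (2 * w $ i) \<cdot>\<^sub>v unit_vec m 0"
  proof (rule eq_vecI)
    fix j assume "j < dim_vec ((2 * w $ i) \<cdot>\<^sub>v unit_vec m 0)"
    then have j: "j < m" by simp
    have "(?P *\<^sub>v u) $ j = 1 * u $ (if j = 0 then i else if j = i then 0 else j)"
      using i k j uc by (intro signed_involution_mult_vec) auto
    also have "\<dots> = ((2 * w $ i) \<cdot>\<^sub>v unit_vec m 0) $ j"
      using i k j by (auto simp: uj)
    finally show "(?P *\<^sub>v u) $ j = ((2 * w $ i) \<cdot>\<^sub>v unit_vec m 0) $ j" .
  qed (simp add: signed_involution_def)
  then show ?thesis using act[OF P uc u] by simp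
qed

text \<open>The \<open>(b + 1) ^ k\<close> vectors with entries \<open>0, ..., b\<close> in the
  block and \<open>0\<close> elsewhere lie in distinct cosets: two in the same coset would put a
  doubled coordinate difference on the first axis into \<open>N\<close>, of absolute value at most
  \<open>2 * b\<close>.\<close>

lemma index_lower_bound:
  assumes N: "N \<in> finite_index_normal G"
    and avoid: "\<And>c. 1 \<le> c \<Longrightarrow> c \<le> 2 * b \<Longrightarrow> (int c \<cdot>\<^sub>v unit_vec m 0, \<one>) \<notin> N"
  shows "(b + 1) ^ k \<le> card (rcosets\<^bsub>G\<^esub> N)"
proof -
  have normal: "N \<lhd> G" and fin: "finite (rcosets\<^bsub>G\<^esub> N)" using N by (auto simp: finite_index_normal_def)
  have sub: "subgroup N G" using normal by (rule normal_imp_subgroup)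
  define e where "e u = vec m (\<lambda>i. if i < k then u i else (0::int))" for u
  let ?U = "PiE {..<k} (\<lambda>_. {0..int b})"
  let ?F = "\<lambda>u. N #>\<^bsub>G\<^esub> (e u, \<one>)"
  have e: "e u \<in> carrier_vec m" "(e u, \<one>) \<in> carrier G" for u by (auto simp: e_def G_simps)
  have "inj_on ?F ?U"
  proof (rule inj_onI)
    fix u u' assume u: "u \<in> ?U" "u' \<in> ?U" "?F u = ?F u'"
    have "(e u, \<one>) \<in> N #>\<^bsub>G\<^esub> (e u', \<one>)"
      using G.repr_independenceD[OF sub e(2) u(3)[symmetric]] .
    then obtain n where n: "n \<in> N" "(e u, \<one>) = n \<otimes>\<^bsub>G\<^esub> (e u', \<one>)" unfolding r_coset_def by auto
    then have "n = (e u, \<one>) \<otimes>\<^bsub>G\<^esub> inv\<^bsub>G\<^esub> (e u', \<one>)"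
      using e G.inv_solve_right subgroup.mem_carrier[OF sub] by metis
    also have "\<dots> = (e u + - e u', \<one>)" using e by (simp add: translation_inv translation_mult)
    finally have w: "(e u + - e u', \<one>) \<in> N" using n by simp
    have "u i = u' i" if i: "i < k" for i
    proof (rule ccontr)
      assume ne: "u i \<noteq> u' i"
      have im: "i < m" using i k by simp
      let ?d = "2 * (u i - u' i)"
      have d: "(?d \<cdot>\<^sub>v unit_vec m 0, \<one>) \<in> N"
        using normal_translations_doubled[OF normal _ w i] e[of u] e[of u'] i im
        by (simp add: e_def)
      \<comment> \<open>The hypothesis \<open>avoid\<close> concerns positive multiples only, so a
        negative \<open>?d\<close> is replaced by its negative.\<close>
      have "(- (?d \<cdot>\<^sub>v unit_vec m 0), \<one>) \<in> N"
        using subgroup.m_inv_closed[OF sub d] by (simp add: translation_inv)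
      also have "- (?d \<cdot>\<^sub>v unit_vec m 0) = (- ?d) \<cdot>\<^sub>v unit_vec m 0"
        by (intro eq_vecI) auto
      finally have "(int (nat \<bar>?d\<bar>) \<cdot>\<^sub>v unit_vec m 0, \<one>) \<in> N"
        using d by (cases "?d \<ge> 0") (simp_all only: abs_of_nonneg abs_of_neg not_le nat_0_le neg_0_le_iff_le less_imp_le neg_0_less_iff_less)
      moreover have "u i \<in> {0..int b}" "u' i \<in> {0..int b}" using u i by (auto simp: PiE_iff)
      then have "1 \<le> nat \<bar>?d\<bar>" "nat \<bar>?d\<bar> \<le> 2 * b" using ne by auto
      ultimately show False using avoid by blast
    qed
    then show "u = u'" using u by (intro PiE_ext[of u "{..<k}" _ u']) auto
  qed
  moreover have "?F ` ?U \<subseteq> rcosets\<^bsub>G\<^esub> N" using e by (auto simp: RCOSETS_def)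
  ultimately have "card ?U \<le> card (rcosets\<^bsub>G\<^esub> N)" using fin by (rule card_inj_on_le)
  moreover have "card ?U = (b + 1) ^ k" by (simp add: card_PiE nat_add_distrib)
  ultimately show ?thesis by simp
qed

section \<open>Generators and the norm of words\<close>

text \<open>Including all of \<open>H\<close> makes the finite part closed under inverses, so an
  inverted letter is a negated unit vector or again an element of \<open>H\<close>.\<close>

definition gens :: "(int vec \<times> 'b) set" where
  "gens = (\<lambda>i. (unit_vec m i, \<one>)) ` {..<m} \<union> {0\<^sub>v m} \<times> carrier H"

lemma finite_gens: "finite gens"
  using finite_H by (simp add: gens_def)

lemma gens_carrier: "gens \<subseteq> carrier G"
  by (auto simp: gens_def G_simps)

lemma gens_letter_cases:
  assumes "s \<in> gens \<union> (\<lambda>s. inv\<^bsub>G\<^esub> s) ` gens"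
  obtains i c where "i < m" "c * c = (1::int)" "s = (c \<cdot>\<^sub>v unit_vec m i, \<one>)"
  | h where "h \<in> carrier H" "s = (0\<^sub>v m, h)"
proof -
  obtain x where x: "x \<in> gens" "s = x \<or> s = inv\<^bsub>G\<^esub> x" using assms by blast
  from x(1) consider i where "i < m" "x = (unit_vec m i, \<one>)" | h where "h \<in> carrier H" "x = (0\<^sub>v m, h)"
    by (auto simp: gens_def)
  then show ?thesis
  proof cases
    case (1 i)
    have "- unit_vec m i = (-1) \<cdot>\<^sub>v (unit_vec m i :: int vec)" by (intro eq_vecI) auto
    then show ?thesis
      using x(2) 1 that(1)[of i 1] that(1)[of i "-1"] by (auto simp: translation_inv)
  next
    case (2 h)
    then show ?thesis using x(2) that(2)[of h] that(2)[of "inv h"] by (auto simp: rotation_inv)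
  qed
qed

text \<open>The triangle inequality for a unit step, squared to stay within the integers: the cross
  term \<open>c * v $ i\<close> is at most \<open>n\<close>.\<close>

lemma scalar_prod_add_unit_le:
  fixes v :: "int vec"
  assumes v: "v \<in> carrier_vec m" and i: "i < m" and c: "c * c = 1" and n: "0 \<le> n" "v \<bullet> v \<le> n\<^sup>2"
  shows "(c \<cdot>\<^sub>v unit_vec m i + v) \<bullet> (c \<cdot>\<^sub>v unit_vec m i + v) \<le> (n + 1)\<^sup>2"
proof -
  let ?e = "c \<cdot>\<^sub>v unit_vec m i"
  have e: "?e \<in> carrier_vec m" by simp
  have 1: "?e \<bullet> ?e = 1" and 2: "?e \<bullet> v = c * v $ i" and 3: "v \<bullet> ?e = c * v $ i"
    using v i c by (auto simp: mult.commute)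
  have "(?e + v) \<bullet> (?e + v) = ?e \<bullet> ?e + v \<bullet> ?e + (?e \<bullet> v + v \<bullet> v)"
    using v e by (simp only: scalar_prod_add_distrib[OF add_carrier_vec[OF e v] e v] add_scalar_prod_distrib[OF e v e] add_scalar_prod_distrib[OF e v v])
  also have "\<dots> = 1 + 2 * (c * v $ i) + v \<bullet> v" unfolding 1 2 3 by simp
  finally have *: "(?e + v) \<bullet> (?e + v) = 1 + 2 * (c * v $ i) + v \<bullet> v" .
  have "(c * v $ i)\<^sup>2 = (v $ i)\<^sup>2" using c by (simp add: power_mult_distrib power2_eq_square[of c])
  also have "\<dots> \<le> n\<^sup>2" using square_le_scalar_prod_self[OF v i] n by simp
  finally have "c * v $ i \<le> n" using n(1) by (rule power2_le_imp_le)
  then show ?thesis unfolding * using n(2) by (simp add: power2_sum)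
qed

text \<open>Prefixing a translation letter raises the norm bound by one, while a letter from
  \<open>H\<close> acts on the translation part by an isometry.\<close>

lemma word_norm:
  assumes "set ws \<subseteq> gens \<union> (\<lambda>s. inv\<^bsub>G\<^esub> s) ` gens"
  shows "\<exists>v h. foldr (\<otimes>\<^bsub>G\<^esub>) ws \<one>\<^bsub>G\<^esub> = (v, h) \<and> v \<in> carrier_vec m \<and> h \<in> carrier H \<and>
    v \<bullet> v \<le> (int (length ws))\<^sup>2"
  using assms
proof (induction ws)
  case Nil
  then show ?case by (auto simp: G_simps)
next
  case (Cons s ws)
  then obtain v h where vh: "foldr (\<otimes>\<^bsub>G\<^esub>) ws \<one>\<^bsub>G\<^esub> = (v, h)" "v \<in> carrier_vec m" "h \<in> carrier H"
    "v \<bullet> v \<le> (int (length ws))\<^sup>2" by auto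
  have "s \<in> gens \<union> (\<lambda>s. inv\<^bsub>G\<^esub> s) ` gens" using Cons.prems by simp
  then show ?case
  proof (cases rule: gens_letter_cases)
    case (1 i c)
    then show ?thesis
      using vh scalar_prod_add_unit_le[OF vh(2) 1(1,2) _ vh(4)] by (simp add: translation_mult add.commute)
  next
    case (2 h')
    have "(int (length ws))\<^sup>2 \<le> (int (length (s # ws)))\<^sup>2" by (intro power_mono) auto
    with vh(4) have "v \<bullet> v \<le> (int (length (s # ws)))\<^sup>2" by (rule order_trans)
    moreover have "(\<phi> h' *\<^sub>v v) \<bullet> (\<phi> h' *\<^sub>v v) = v \<bullet> v"
      using orthogonal_fixing_norm[OF phi_orthogonal[OF 2(1)] vh(2)] .
    ultimately show ?thesis
      using vh 2 by (simp add: G_simps(3) phi_vec_carrier)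
  qed
qed

lemma word_ball_coord:
  assumes "(v, h) \<in> word_ball G gens r" "i < m"
  shows "real_of_int \<bar>v $ i\<bar> \<le> r"
proof -
  obtain ws where ws: "(v, h) = foldr (\<otimes>\<^bsub>G\<^esub>) ws \<one>\<^bsub>G\<^esub>" "set ws \<subseteq> gens \<union> (\<lambda>s. inv\<^bsub>G\<^esub> s) ` gens"
    "real (length ws) \<le> r"
    using assms(1) unfolding word_ball_def by auto
  have v: "v \<in> carrier_vec m" "v \<bullet> v \<le> (int (length ws))\<^sup>2"
    using word_norm[OF ws(2)] unfolding ws(1)[symmetric] by auto
  have "\<bar>v $ i\<bar>\<^sup>2 \<le> (int (length ws))\<^sup>2"
    using square_le_scalar_prod_self[OF v(1) assms(2)] v(2) by simp
  then have "\<bar>v $ i\<bar> \<le> int (length ws)" by (rule power2_le_imp_le) simp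
  then show ?thesis using ws(3) by linarith
qed

lemma generate_gens: "generate G gens = carrier G"
proof
  show "generate G gens \<subseteq> carrier G" using G.generate_incl[OF gens_carrier] .
  have sub: "subgroup (generate G gens) G" using G.generate_is_subgroup[OF gens_carrier] .
  let ?K = "generate G gens"
  have mult: "(u + v, \<one>) \<in> ?K" if "(u, \<one>) \<in> ?K" "(v, \<one>) \<in> ?K" "v \<in> carrier_vec m" for u v
    using subgroup.m_closed[OF sub that(1,2)] that(3) by (simp add: translation_mult)
  have unit_mem: "(unit_vec m i, \<one>) \<in> ?K" "(- unit_vec m i, \<one>) \<in> ?K" if "i < m" for i
  proof -
    show *: "(unit_vec m i, \<one>) \<in> ?K" using that by (intro generate.incl) (auto simp: gens_def)
    show "(- unit_vec m i, \<one>) \<in> ?K" using subgroup.m_inv_closed[OF sub *] by (simp add: translation_inv)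
  qed
  have line: "(c \<cdot>\<^sub>v unit_vec m i, \<one>) \<in> ?K" if i: "i < m" for c i
  proof (induction c rule: int_induct[where k = 0])
    case base
    have "(0 \<cdot>\<^sub>v unit_vec m i, \<one>) = \<one>\<^bsub>G\<^esub>" by (auto simp: G_simps)
    then show ?case using subgroup.one_closed[OF sub] by simp
  next
    case (step1 c)
    have "c \<cdot>\<^sub>v unit_vec m i + unit_vec m i = (c + 1) \<cdot>\<^sub>v unit_vec m i"
      by (intro eq_vecI) (auto simp: algebra_simps)
    then show ?case using mult[OF step1(2) unit_mem(1)[OF i]] by simp
  next
    case (step2 c)
    have "c \<cdot>\<^sub>v unit_vec m i + - unit_vec m i = (c - 1) \<cdot>\<^sub>v unit_vec m i"
      by (intro eq_vecI) (auto simp: algebra_simps)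
    then show ?case using mult[OF step2(2) unit_mem(2)[OF i]] by simp
  qed
  \<comment> \<open>Induction on the number \<open>n\<close> of leading coordinates that may be
    nonzero; the step clears the last of them with a multiple of a unit vector.\<close>
  have transl: "(v, \<one>) \<in> ?K"
    if "n \<le> m" "v \<in> carrier_vec m" "\<forall>j. n \<le> j \<and> j < m \<longrightarrow> v $ j = 0" for v n
    using that
  proof (induction n arbitrary: v)
    case 0
    then have "v = 0\<^sub>v m" by (intro eq_vecI) auto
    then show ?case using subgroup.one_closed[OF sub] by (simp add: G_simps)
  next
    case (Suc n)
    define w where "w = v + (- v $ n) \<cdot>\<^sub>v unit_vec m n"
    have wj: "w $ j = (if j = n then 0 else v $ j)" if "j < m" for j
      using that Suc.prems by (auto simp: w_def)
    have w: "w \<in> carrier_vec m" using Suc.prems by (simp add: w_def)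
    have "(w, \<one>) \<in> ?K"
      using Suc.prems w wj by (intro Suc.IH) (auto simp: le_Suc_eq not_less_eq_eq)
    moreover have "w + v $ n \<cdot>\<^sub>v unit_vec m n = v"
      using Suc.prems w by (intro eq_vecI) (auto simp: wj)
    ultimately show ?case using mult[OF _ line[of n "v $ n"], of w] Suc.prems by simp
  qed
  show "carrier G \<subseteq> ?K"
  proof
    fix x assume "x \<in> carrier G"
    then obtain v h where x: "x = (v, h)" "v \<in> carrier_vec m" "h \<in> carrier H" by (auto simp: G_simps)
    have "(v, \<one>) \<in> ?K" using transl[of m v] x by simp
    moreover have "(0\<^sub>v m, h) \<in> ?K" using x by (intro generate.incl) (auto simp: gens_def)
    moreover have "(v, \<one>) \<otimes>\<^bsub>G\<^esub> (0\<^sub>v m, h) = x" using x by (simp add: translation_mult)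
    ultimately show "x \<in> ?K" using subgroup.m_closed[OF sub] by fastforce
  qed
qed

section \<open>Quantitative residual finiteness\<close>

lemma separating_index:
  assumes "(v, h) \<in> carrier G" "(v, h) \<noteq> \<one>\<^bsub>G\<^esub>" "1 \<le> s" "\<And>i. i < m \<Longrightarrow> \<bar>v $ i\<bar> < 2 ^ s"
  shows "\<exists>N\<in>finite_index_normal G. (v, h) \<notin> N \<and>
    card (rcosets\<^bsub>G\<^esub> N) \<le> (2 * s) ^ k * card (carrier H)"
proof (cases "h = \<one>")
  case False
  have "card (carrier H) \<le> (2 * s) ^ k * card (carrier H)" using assms(3) by simp
  then show ?thesis using rotation_separated[OF assms(1) False] order_trans by blast
next
  case True
  have v: "v \<in> carrier_vec m" using assms(1) by (simp add: G_simps)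
  have "v \<noteq> 0\<^sub>v m" using assms(2) True by (auto simp: G_simps)
  then obtain i where i: "i < m" "v $ i \<noteq> 0" using v by (metis carrier_vecD eq_vecI index_zero_vec)
  obtain c where c: "1 \<le> c" "c \<le> 2 * s" "\<not> int c dvd v $ i"
    using ex_small_nondivisor[OF i(2) assms(3) assms(4)[OF i(1)]] by blast
  have "c ^ k * card (carrier H) \<le> (2 * s) ^ k * card (carrier H)"
    using c(2) by (intro mult_right_mono power_mono) auto
  then show ?thesis using translation_separated[OF v i(1) c(1,3)] order_trans True by blast
qed

lemma residually_finite_G: "residually_finite G"
  unfolding residually_finite_def
proof
  fix g assume g: "g \<in> carrier G - {\<one>\<^bsub>G\<^esub>}"
  obtain v h where vh: "g = (v, h)" by (cases g)
  \<comment> \<open>A crude choice is enough here: \<open>s\<close> exceeds every entry in absolute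
    value, and \<open>s < 2 ^ s\<close>.\<close>
  define s where "s = Suc (\<Sum>j<m. nat \<bar>v $ j\<bar>)"
  have "\<bar>v $ i\<bar> < 2 ^ s" if "i < m" for i
  proof -
    have "nat \<bar>v $ i\<bar> \<le> (\<Sum>j<m. nat \<bar>v $ j\<bar>)" using that by (intro member_le_sum) auto
    then have "nat \<bar>v $ i\<bar> < s" by (simp add: s_def)
    also have "s < 2 ^ s" by (rule less_exp)
    finally show ?thesis by (simp add: nat_less_iff)
  qed
  then show "\<exists>N\<in>finite_index_normal G. g \<notin> N"
    using separating_index[of v h s] g vh by (auto simp: s_def)
qed

section \<open>Two-sided logarithmic bounds for the growth\<close>

lemma replicate_word: "foldr (\<otimes>\<^bsub>G\<^esub>) (replicate n (unit_vec m 0, \<one>)) \<one>\<^bsub>G\<^esub> = (int n \<cdot>\<^sub>v unit_vec m 0, \<one>)"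
proof (induction n)
  case 0
  show ?case by (auto simp: G_simps)
next
  case (Suc n)
  have "unit_vec m 0 + int n \<cdot>\<^sub>v unit_vec m 0 = int (Suc n) \<cdot>\<^sub>v unit_vec m 0"
    by (intro eq_vecI) (auto simp: algebra_simps)
  then show ?case using Suc by (simp add: translation_mult)
qed

lemma first_axis_in_word_ball:
  assumes "real n \<le> r"
  shows "(int n \<cdot>\<^sub>v unit_vec m 0, \<one>) \<in> word_ball G gens r"
  unfolding word_ball_def replicate_word[symmetric]
  using assms k by (intro CollectI exI[of _ "replicate n (unit_vec m 0, \<one>)"]) (auto simp: gens_def)

lemma first_axis_ne_one:
  assumes "1 \<le> n"
  shows "(int n \<cdot>\<^sub>v unit_vec m 0, \<one>) \<noteq> \<one>\<^bsub>G\<^esub>"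
proof
  assume "(int n \<cdot>\<^sub>v unit_vec m 0, \<one>) = \<one>\<^bsub>G\<^esub>"
  then have "(int n \<cdot>\<^sub>v unit_vec m 0) $ 0 = (0\<^sub>v m :: int vec) $ 0" by (simp add: G_simps)
  then show False using assms k by simp
qed

text \<open>The argument \<open>2 * r\<close> keeps the bound positive at \<open>r = 1\<close>,
  where \<open>ln r\<close> vanishes; the growth relation absorbs the rescaling.\<close>

lemma RF_growth_upper:
  assumes "1 \<le> r"
  shows "RF_growth G gens r \<le> (2 / ln 2) ^ k * real (card (carrier H)) * ln (2 * r) ^ k"
\<comment> \<open>The first unit vector lies in every ball of radius at least \<open>1\<close>, so
  the maximum ranges over a nonempty set.\<close>
proof (rule RF_growth_le[OF finite_gens first_axis_in_word_ball[of 1] first_axis_ne_one])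
  fix g assume g: "g \<in> word_ball G gens r" "g \<noteq> \<one>\<^bsub>G\<^esub>"
  obtain v h where vh: "g = (v, h)" by (cases g)
  \<comment> \<open>The least natural number above \<open>log 2 r\<close>: it gives
    \<open>r < 2 ^ s\<close>, while \<open>s\<close> is at most
    \<open>log 2 (2 * r)\<close>.\<close>
  define s where "s = Suc (nat \<lfloor>log 2 r\<rfloor>)"
  have l: "0 \<le> log 2 r" using assms by simp
  have s: "log 2 r < real s" "real s \<le> log 2 r + 1" using l by (auto simp: s_def; linarith)+
  have "r = 2 powr log 2 r" using assms by simp
  also have "\<dots> < 2 powr real s" using s(1) by simp
  finally have rs: "r < 2 ^ s" by (simp add: powr_realpow)
  have "\<bar>v $ i\<bar> < 2 ^ s" if "i < m" for i
  proof -
    have "real_of_int \<bar>v $ i\<bar> < 2 ^ s" using word_ball_coord[of v h r i] g(1) vh that rs by simp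
    then show ?thesis by (metis of_int_less_iff of_int_numeral of_int_power)
  qed
  moreover have "g \<in> carrier G" using word_ball_subset_carrier[OF group_G gens_carrier] g(1) by blast
  ultimately obtain N where N: "N \<in> finite_index_normal G" "g \<notin> N"
    "card (rcosets\<^bsub>G\<^esub> N) \<le> (2 * s) ^ k * card (carrier H)"
    using separating_index[of v h s] g(2) vh by (auto simp: s_def)
  have "divisibility G g \<le> (2 * s) ^ k * card (carrier H)"
    using divisibility_le[OF N(1,2)] N(3) by simp
  then have "real (divisibility G g) \<le> real ((2 * s) ^ k * card (carrier H))" by (rule of_nat_mono)
  also have "\<dots> = (2 * real s) ^ k * real (card (carrier H))" by simp
  also have "\<dots> \<le> (2 / ln 2 * ln (2 * r)) ^ k * real (card (carrier H))"
  proof (intro mult_right_mono power_mono)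
    have "log 2 (2 * r) = log 2 r + 1" using assms by (simp add: log_mult)
    then show "2 * real s \<le> 2 / ln 2 * ln (2 * r)" using s(2) by (simp add: log_def)
  qed auto
  finally show "real (divisibility G g) \<le> (2 / ln 2) ^ k * real (card (carrier H)) * ln (2 * r) ^ k"
    by (simp only: power_mult_distrib mult_ac)
qed (use assms in auto)

lemma translation_multiple:
  assumes "subgroup N G" "(w, \<one>) \<in> N" "w \<in> carrier_vec m"
  shows "(int n \<cdot>\<^sub>v w, \<one>) \<in> N"
proof (induction n)
  case 0
  have "(0 \<cdot>\<^sub>v w, \<one>) = \<one>\<^bsub>G\<^esub>" using assms(3) by (auto simp: G_simps)
  then show ?case using subgroup.one_closed[OF assms(1)] by simp
next
  case (Suc n)
  have "int n \<cdot>\<^sub>v w + w = int (Suc n) \<cdot>\<^sub>v w"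
    by (intro eq_vecI) (auto simp: algebra_simps)
  then show ?case
    using subgroup.m_closed[OF assms(1) Suc assms(2)] assms(3) by (simp add: translation_mult)
qed

text \<open>Each positive \<open>c \<le> 2 ^ t\<close> divides the tower, so a subgroup avoiding
  this multiple of the first unit vector avoids all those smaller multiples too.\<close>

lemma divisibility_binomial_tower:
  "(2 ^ t div 2 + 1) ^ k \<le> divisibility G (int (binomial_tower t) \<cdot>\<^sub>v unit_vec m 0, \<one>)"
proof (rule divisibility_ge)
  let ?g = "(int (binomial_tower t) \<cdot>\<^sub>v unit_vec m 0, \<one>)"
  have "?g \<noteq> \<one>\<^bsub>G\<^esub>" using binomial_tower_pos[of t] by (intro first_axis_ne_one) simp
  moreover have "?g \<in> carrier G" by (simp add: G_simps)
  ultimately show "\<exists>N\<in>finite_index_normal G. ?g \<notin> N"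
    using residually_finite_G unfolding residually_finite_def by blast
  fix N assume N: "N \<in> finite_index_normal G" "?g \<notin> N"
  then have sub: "subgroup N G" by (simp add: finite_index_normal_def normal_imp_subgroup)
  show "(2 ^ t div 2 + 1) ^ k \<le> card (rcosets\<^bsub>G\<^esub> N)"
  proof (rule index_lower_bound[OF N(1)])
    fix c :: nat assume c: "1 \<le> c" "c \<le> 2 * (2 ^ t div 2)"
    have "c \<le> 2 ^ t" using c(2) by (rule order_trans) simp
    then obtain q where q: "binomial_tower t = c * q" using dvd_binomial_tower[OF c(1)] by blast
    show "(int c \<cdot>\<^sub>v unit_vec m 0, \<one>) \<notin> N"
    proof
      assume "(int c \<cdot>\<^sub>v unit_vec m 0, \<one>) \<in> N"
      then have "(int q \<cdot>\<^sub>v (int c \<cdot>\<^sub>v unit_vec m 0), \<one>) \<in> N"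
        by (rule translation_multiple[OF sub]) simp
      then show False using N(2) by (simp add: q smult_smult_assoc mult.commute)
    qed
  qed
qed

lemma RF_growth_lower:
  assumes "4 \<le> r"
  shows "(ln r / (4 * ln 4)) ^ k \<le> RF_growth G gens r"
proof -
  have "\<exists>n. r < 4 ^ 2 ^ n"
  proof -
    obtain n where "r < real n" using reals_Archimedean2 by blast
    also have "real n < 2 ^ n" by (rule of_nat_less_two_power)
    also have "\<dots> < 2 ^ 2 ^ n" by (intro power_strict_increasing) (auto simp: less_exp)
    also have "\<dots> \<le> (4::real) ^ 2 ^ n" by (intro power_mono) auto
    finally show ?thesis by blast
  qed
  \<comment> \<open>Minimality of \<open>n = Suc t\<close> places \<open>r\<close> between
    \<open>4 ^ 2 ^ t\<close> and its square; \<open>r \<ge> 4\<close> excludes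
    \<open>n = 0\<close>.\<close>
  define n where "n = (LEAST n. r < 4 ^ 2 ^ n)"
  have n: "r < 4 ^ 2 ^ n" unfolding n_def by (rule LeastI_ex) fact
  have "n \<noteq> 0" using n assms by (intro notI) simp
  then obtain t where t: "n = Suc t" by (cases n) auto
  have "\<not> r < 4 ^ 2 ^ t" using not_less_Least[of t "\<lambda>n. r < 4 ^ 2 ^ n"] t unfolding n_def by simp
  then have tr: "4 ^ 2 ^ t \<le> r" by simp
  have "real (binomial_tower t) \<le> 4 ^ 2 ^ t"
    using binomial_tower_le[of t] by (metis of_nat_le_iff of_nat_numeral of_nat_power)
  then have "real (binomial_tower t) \<le> r" using tr by (rule order_trans)
  then have "real (divisibility G (int (binomial_tower t) \<cdot>\<^sub>v unit_vec m 0, \<one>)) \<le> RF_growth G gens r"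
    using binomial_tower_pos[of t]
    by (intro divisibility_le_RF_growth finite_gens first_axis_in_word_ball first_axis_ne_one) auto
  moreover have "real ((2 ^ t div 2 + 1) ^ k) \<le>
      real (divisibility G (int (binomial_tower t) \<cdot>\<^sub>v unit_vec m 0, \<one>))"
    by (intro of_nat_mono divisibility_binomial_tower)
  moreover have "(ln r / (4 * ln 4)) ^ k \<le> real ((2 ^ t div 2 + 1) ^ k)"
  proof -
    \<comment> \<open>The constant \<open>4\<close> combines a factor \<open>2\<close> from passing
      to the next scale \<open>Suc t\<close> with a factor \<open>2\<close> from halving
      \<open>2 ^ t\<close>.\<close>
    have "ln r < ln (4 ^ 2 ^ n)" using n assms by (subst ln_less_cancel_iff) auto
    also have "\<dots> = 2 * 2 ^ t * ln 4" by (simp add: t ln_realpow)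
    finally have "ln r / (4 * ln 4) \<le> 2 ^ t / 2" by (simp add: field_simps)
    also have "\<dots> \<le> real (2 ^ t div 2 + 1)" by (cases t) auto
    finally show ?thesis using assms by (simp add: power_mono)
  qed
  ultimately show ?thesis by linarith
qed

theorem RF_equals_log_power: "RF_equals G (\<lambda>r. ln r ^ k)"
proof -
  have "growth_le (RF_growth G gens) (\<lambda>r. ln r ^ k)"
  proof -
    define C0 where "C0 = (2 / ln 2) ^ k * real (card (carrier H))"
    \<comment> \<open>A single constant must serve as multiplier and as rescaling of the argument,
      hence the maximum.\<close>
    define C where "C = max 2 C0"
    have "RF_growth G gens r \<le> C * ln (C * r) ^ k" if "max 1 (1 / C) \<le> r" for r
    proof -
      have r: "1 \<le> r" using that by simp
      have "RF_growth G gens r \<le> C0 * ln (2 * r) ^ k"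
        using RF_growth_upper[OF r] by (simp add: C0_def)
      also have "\<dots> \<le> C * ln (C * r) ^ k"
        using r by (intro mult_mono power_mono) (auto simp: C_def)
      finally show ?thesis .
    qed
    then show ?thesis unfolding growth_le_def by (intro exI[of _ C]) (auto simp: C_def)
  qed
  moreover have "growth_le (\<lambda>r. ln r ^ k) (RF_growth G gens)"
  proof -
    \<comment> \<open>With \<open>C \<ge> 4\<close> the radius \<open>C * r\<close> is in the range
      of the lower bound even for \<open>r = 1\<close>; the other term undoes the division by
      \<open>4 * ln 4\<close>.\<close>
    define C where "C = max 4 ((4 * ln 4) ^ k :: real)"
    have "ln r ^ k \<le> C * RF_growth G gens (C * r)" if "max 1 (1 / C) \<le> r" for r
    proof -
      have r: "1 \<le> r" using that by simp
      have "4 * 1 \<le> C * r" using r by (intro mult_mono) (auto simp: C_def)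
      then have low: "(ln (C * r) / (4 * ln 4)) ^ k \<le> RF_growth G gens (C * r)"
        by (intro RF_growth_lower) simp
      have "1 * r \<le> C * r" using r by (intro mult_right_mono) (auto simp: C_def)
      then have "ln r ^ k \<le> ln (C * r) ^ k" using r by (intro power_mono) auto
      also have "\<dots> = (4 * ln 4) ^ k * (ln (C * r) / (4 * ln 4)) ^ k"
        by (simp add: power_divide)
      also have "\<dots> \<le> C * RF_growth G gens (C * r)"
        using \<open>4 * 1 \<le> C * r\<close> by (intro mult_mono low) (auto simp: C_def)
      finally show ?thesis .
    qed
    then show ?thesis unfolding growth_le_def by (intro exI[of _ C]) (auto simp: C_def)
  qed
  ultimately show ?thesis
    unfolding RF_equals_def growth_equiv_def generating_set_def
    using group_G residually_finite_G finite_gens gens_carrier generate_gens by blast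
qed

end

section \<open>Realising powers of the logarithm\<close>

lemma group_image_group:
  assumes "group G" "inj_on f (carrier G)"
  shows "group (image_group f G)"
  using group.iso_imp_img_group[OF assms(1) inj_imp_image_group_iso[OF assms(2)]]
  by (simp add: image_group_def)

lemma subgroup_orthogonal_fixing: "subgroup (orthogonal_fixing m k) (GL_int m)"
proof -
  interpret GL: group "GL_int m" by (rule group_GL_int)
  note sub = orthogonal_fixing_subset_GL_int[of m k]
  show ?thesis
  proof (rule GL.subgroupI[OF sub])
    show "orthogonal_fixing m k \<noteq> {}" using orthogonal_fixing_one by blast
    show "inv\<^bsub>GL_int m\<^esub> A \<in> orthogonal_fixing m k" if A: "A \<in> orthogonal_fixing m k" for A
    proof -
      have "A\<^sup>T * A = 1\<^sub>m m" using A by (auto simp: orthogonal_fixing_def)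
      then have "inv\<^bsub>GL_int m\<^esub> A = A\<^sup>T"
        using A orthogonal_fixing_transpose[OF A] sub by (intro GL.inv_equality) (auto simp: GL_int_simps(2,3))
      then show ?thesis using orthogonal_fixing_transpose[OF A] by simp
    qed
  qed (simp add: GL_int_simps(2) orthogonal_fixing_mult)
qed

text \<open>The matrix group is finite, so an injection copies it to \<open>nat\<close>;
  \<open>\<phi>\<close> is the inverse of this copying map.\<close>

lemma ex_orthogonal_semidirect:
  assumes "1 \<le> k" "k \<le> m"
  shows "\<exists>(H :: nat monoid) \<phi>. orthogonal_semidirect H m k \<phi>"
proof -
  let ?O = "(GL_int m)\<lparr>carrier := orthogonal_fixing m k\<rparr>"
  have O: "group ?O"
    using subgroup.subgroup_is_group[OF subgroup_orthogonal_fixing group_GL_int] .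
  obtain f :: "int mat \<Rightarrow> nat" where f: "inj_on f (orthogonal_fixing m k)"
    using finite_imp_inj_to_nat_seg[OF finite_orthogonal_fixing] by blast
  let ?H = "image_group f ?O"
  have iso: "f \<in> iso ?O ?H" using f by (intro inj_imp_image_group_iso) simp
  define \<phi> where "\<phi> = inv_into (carrier ?O) f"
  have "\<phi> \<in> iso ?H ?O" unfolding \<phi>_def using group.iso_set_sym[OF O iso] .
  then have hom: "\<phi> \<in> hom ?H ?O" and img: "\<phi> ` carrier ?H = orthogonal_fixing m k"
    by (auto simp: iso_def bij_betw_def)
  have "\<phi> \<in> hom ?H (GL_int m)"
    using hom orthogonal_fixing_subset_GL_int[of m k] by (auto simp: hom_def Pi_iff subset_iff)
  moreover have "group ?H" using O f by (intro group_image_group) auto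
  moreover have "finite (carrier ?H)" by (simp add: image_group_carrier finite_orthogonal_fixing)
  ultimately have "orthogonal_semidirect ?H m k \<phi>"
    using assms img by (simp add: orthogonal_semidirect_def orthogonal_semidirect_axioms_def)
  then show ?thesis by blast
qed

section \<open>Exponent zero and groups on the natural numbers\<close>

text \<open>The growth lies between \<open>1\<close> and the index of the trivial subgroup. A
  nontrivial element keeps the maximum over a nonempty set.\<close>

lemma RF_equals_finite_group:
  assumes "group G" "finite (carrier G)" "carrier G \<noteq> {\<one>\<^bsub>G\<^esub>}"
  shows "RF_equals G (\<lambda>_. 1)"
proof -
  interpret group G by fact
  let ?RF = "RF_growth G (carrier G)" and ?K = "card (rcosets\<^bsub>G\<^esub> {\<one>\<^bsub>G\<^esub>})"
  have fin: "finite (rcosets\<^bsub>G\<^esub> {\<one>\<^bsub>G\<^esub>})"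
    using assms(2) rcosets_part_G[OF normal_imp_subgroup[OF one_is_normal]] by (metis finite_UnionD)
  have triv: "{\<one>\<^bsub>G\<^esub>} \<in> finite_index_normal G"
    using one_is_normal fin by (simp add: finite_index_normal_def)
  obtain g where g: "g \<in> carrier G" "g \<noteq> \<one>\<^bsub>G\<^esub>" using assms(3) one_closed by blast
  have ball: "g \<in> word_ball G (carrier G) r" if "1 \<le> r" for r
    unfolding word_ball_def using g that by (intro CollectI exI[of _ "[g]"]) auto
  have upper: "?RF r \<le> ?K" if "1 \<le> r" for r
    using divisibility_le[OF triv] by (intro RF_growth_le[OF assms(2) ball[OF that] g(2)]) auto
  have lower: "1 \<le> ?RF r" if "1 \<le> r" for r
  proof -
    have "1 \<le> divisibility G g"
    proof (rule divisibility_ge)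
      show "\<exists>N\<in>finite_index_normal G. g \<notin> N" using triv g(2) by blast
      fix N assume "N \<in> finite_index_normal G"
      then have "finite (rcosets\<^bsub>G\<^esub> N)" by (simp add: finite_index_normal_def)
      moreover have "rcosets\<^bsub>G\<^esub> N \<noteq> {}" using one_closed by (auto simp: RCOSETS_def)
      ultimately show "1 \<le> card (rcosets\<^bsub>G\<^esub> N)" by (simp add: Suc_le_eq card_gt_0_iff)
    qed
    then show ?thesis using divisibility_le_RF_growth[OF assms(2) ball[OF that] g(2)] by linarith
  qed
  have "growth_le ?RF (\<lambda>_. 1)"
    unfolding growth_le_def by (intro exI[of _ "max 1 (real ?K)"]) (auto simp: le_max_iff_disj upper)
  moreover have "growth_le (\<lambda>_. 1) ?RF"
    unfolding growth_le_def by (intro exI[of _ 1]) (auto simp: lower)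
  moreover have "residually_finite G" using triv by (auto simp: residually_finite_def)
  moreover have "generate G (carrier G) = carrier G"
    using generate_incl[of "carrier G"] generate.incl[of _ "carrier G" G] by blast
  ultimately show ?thesis
    unfolding RF_equals_def growth_equiv_def generating_set_def using assms(1,2) by blast
qed

lemma group_parity: "group \<lparr>carrier = {0, 1::nat}, monoid.mult = (\<lambda>a b. (a + b) mod 2), one = 0\<rparr>"
  by (rule groupI) auto

text \<open>Vectors are encoded through their lists of entries, which form a countable type.\<close>

lemma inj_encode_lattice_semidirect: "inj (\<lambda>(v :: int vec, h :: nat). to_nat (list_of_vec v, h))"
proof (rule injI)
  fix x y :: "int vec \<times> nat"
  assume "(case x of (v, h) \<Rightarrow> to_nat (list_of_vec v, h)) = (case y of (v, h) \<Rightarrow> to_nat (list_of_vec v, h))"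
  then have "list_of_vec (fst x) = list_of_vec (fst y)" "snd x = snd y" by (auto simp: case_prod_beta)
  then show "x = y" by (metis prod_eqI vec_list)
qed

theorem corollary6p1:
  shows "(\<forall>m\<ge>1. \<forall>k. 1 \<le> k \<and> k \<le> m \<longrightarrow>
            (\<exists>(H :: nat monoid) \<phi>.
               group H \<and> finite (carrier H) \<and> \<phi> \<in> hom H (GL_int m) \<and>
               RF_equals (lattice_semidirect m H \<phi>) (\<lambda>r. ln r ^ k)))
       \<and> (\<forall>k::nat. \<exists>G :: nat monoid.
            group G \<and> finitely_generated G \<and> residually_finite G \<and>
            RF_equals G (\<lambda>r. ln r ^ k))"
proof (intro conjI allI impI)
  fix m k :: nat assume "1 \<le> k \<and> k \<le> m"
  then obtain H :: "nat monoid" and \<phi> where "orthogonal_semidirect H m k \<phi>"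
    using ex_orthogonal_semidirect by blast
  then interpret orthogonal_semidirect H m k \<phi> .
  show "\<exists>(H :: nat monoid) \<phi>. group H \<and> finite (carrier H) \<and> \<phi> \<in> hom H (GL_int m) \<and>
      RF_equals (lattice_semidirect m H \<phi>) (\<lambda>r. ln r ^ k)"
    using RF_equals_log_power hom finite_H H.group_axioms by blast
next
  fix k :: nat
  have "\<exists>G :: nat monoid. RF_equals G (\<lambda>r. ln r ^ k)"
  proof (cases "k = 0")
    case True
    \<comment> \<open>For exponent zero the target is the constant \<open>1\<close>, so a group of
      order two serves.\<close>
    have "RF_equals \<lparr>carrier = {0, 1::nat}, monoid.mult = (\<lambda>a b. (a + b) mod 2), one = 0\<rparr> (\<lambda>_. 1)"
      by (rule RF_equals_finite_group[OF group_parity]) auto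
    then show ?thesis using True by auto
  next
    case False
    then have "1 \<le> k" by simp
    \<comment> \<open>Rank \<open>m = k\<close> suffices for a given exponent, with no fixed
      coordinates left over.\<close>
    then obtain H :: "nat monoid" and \<phi> where "orthogonal_semidirect H k k \<phi>"
      using ex_orthogonal_semidirect by blast
    then interpret orthogonal_semidirect H k k \<phi> .
    let ?f = "\<lambda>(v :: int vec, h :: nat). to_nat (list_of_vec v, h)"
    have inj: "inj_on ?f (carrier G)"
      using inj_encode_lattice_semidirect by (rule inj_on_subset) simp
    show ?thesis
      using RF_equals_iso[OF group_image_group[OF group_G inj] inj_imp_image_group_iso[OF inj]
        RF_equals_log_power] by (rule exI)
  qed
  then show "\<exists>G :: nat monoid. group G \<and> finitely_generated G \<and> residually_finite G \<and>
      RF_equals G (\<lambda>r. ln r ^ k)"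
    using RF_equals_imp_finitely_generated unfolding RF_equals_def by blast
qed

end
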